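(* Let $(X,\rho)$ be a compact, dense-in-itself metric space with $\rho(x,y)\le 1$ for all $x,y\in X$, and let $\mathcal{F}$ be a family of $F_\sigma$ subsets of $X$. Then $\mathcal{F}$ is $\mathcal{K}^{\mathbb{N}}$-residual if and only if $\mathcal{F}$ is $\mathcal{K}_{\nearrow}^{\mathbb{N}}$-residual.
   Context: Dense-in-itself means having no isolated points. $\mathbb{N}=\{1,2,3,\dots\}$, and sequences are indexed by $\mathbb{N}$. $\mathcal{K}$ is the set of all compact (equivalently closed) subsets of $X$, including the empty set, with the Hausdorff metric $d$, where $d(K,\emptyset)=1$ for every nonempty $K\in\mathcal{K}$ (and $d(\emptyset,\emptyset)=0$); this makes $\mathcal{K}$ a compact metric space. $\mathcal{K}^{\mathbb{N}}$ is the set of all sequences $(K_n)$ in $\mathcal{K}$ with the product topology, and $$\mathcal{K}_{\nearrow}^{\mathbb{N}}=\{(K_n)\in\mathcal{K}^{\mathbb{N}} : K_1\subset K_2\subset\cdots\}$$ is the closed subset of increasing (not necessarily strictly) sequences, with the subspace topology. For a family $\mathcal{F}$ of $F_\sigma$ subsets of $X$, put $$\mathcal{K}_{\mathcal{F}}^{\mathbb{N}}=\Bigl\{(K_n)\in\mathcal{K}^{\mathbb{N}} : \bigcup_{n=1}^{\infty}K_n\in\mathcal{F}\Bigr\}.$$ $\mathcal{F}$ is called $\mathcal{K}^{\mathbb{N}}$-residual if $\mathcal{K}_{\mathcal{F}}^{\mathbb{N}}$ is residual in $\mathcal{K}^{\mathbb{N}}$, and $\mathcal{K}_{\nearrow}^{\mathbb{N}}$-residual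 if $\mathcal{K}_{\mathcal{F}}^{\mathbb{N}}\cap\mathcal{K}_{\nearrow}^{\mathbb{N}}$ is residual in the space $\mathcal{K}_{\nearrow}^{\mathbb{N}}$. A subset of a topological space is residual if its complement is meagre (a countable union of nowhere dense sets). *)

theory Defs
  imports "HOL-Analysis.Analysis"
begin

definition dense_in_itself :: "'a topology \<Rightarrow> bool" where
  "dense_in_itself T \<longleftrightarrow> (\<forall>x \<in> topspace T. \<not> openin T {x})"

definition nowhere_dense_in :: "'a topology \<Rightarrow> 'a set \<Rightarrow> bool" where
  "nowhere_dense_in T S \<longleftrightarrow> S \<subseteq> topspace T \<and> T interior_of (T closure_of S) = {}"

definition meagre_in :: "'a topology \<Rightarrow> 'a set \<Rightarrow> bool" where
  "meagre_in T = countable union_of nowhere_dense_in T"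

definition residual_in :: "'a topology \<Rightarrow> 'a set \<Rightarrow> bool" where
  "residual_in T S \<longleftrightarrow> S \<subseteq> topspace T \<and> meagre_in T (topspace T - S)"

definition compact_subsets :: "'a set \<Rightarrow> ('a \<Rightarrow> 'a \<Rightarrow> real) \<Rightarrow> 'a set set" where
  "compact_subsets X \<rho> = {K. compactin (Metric_space.mtopology X \<rho>) K}"

text \<open>The value \<open>0\<close> off \<open>compact_subsets X \<rho>\<close> is a dummy: the locale \<open>Metric_space\<close>
  requires nonnegativity and symmetry of the distance on the whole type.\<close>

definition hausdorff_dist :: "'a set \<Rightarrow> ('a \<Rightarrow> 'a \<Rightarrow> real) \<Rightarrow> 'a set \<Rightarrow> 'a set \<Rightarrow> real" where
  "hausdorff_dist X \<rho> A B =
     (if A \<in> compact_subsets X \<rho> \<and> B \<in> compact_subsets X \<rho> then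
        (if A = {} \<and> B = {} then 0
         else if A = {} \<or> B = {} then 1
         else max (SUP a\<in>A. INF b\<in>B. \<rho> a b) (SUP b\<in>B. INF a\<in>A. \<rho> a b))
      else 0)"

definition hyperspace :: "'a set \<Rightarrow> ('a \<Rightarrow> 'a \<Rightarrow> real) \<Rightarrow> 'a set topology" where
  "hyperspace X \<rho> = Metric_space.mtopology (compact_subsets X \<rho>) (hausdorff_dist X \<rho>)"

text \<open>Sequences are indexed from \<open>0\<close>.\<close>

definition seq_space :: "'a set \<Rightarrow> ('a \<Rightarrow> 'a \<Rightarrow> real) \<Rightarrow> (nat \<Rightarrow> 'a set) topology" where
  "seq_space X \<rho> = product_topology (\<lambda>_. hyperspace X \<rho>) UNIV"

definition increasing_seqs :: "'a set \<Rightarrow> ('a \<Rightarrow> 'a \<Rightarrow> real) \<Rightarrow> (nat \<Rightarrow> 'a set) set" where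
  "increasing_seqs X \<rho> = {K \<in> topspace (seq_space X \<rho>). \<forall>n. K n \<subseteq> K (Suc n)}"

definition increasing_seq_space :: "'a set \<Rightarrow> ('a \<Rightarrow> 'a \<Rightarrow> real) \<Rightarrow> (nat \<Rightarrow> 'a set) topology" where
  "increasing_seq_space X \<rho> = subtopology (seq_space X \<rho>) (increasing_seqs X \<rho>)"

definition seqs_with_union_in ::
    "'a set \<Rightarrow> ('a \<Rightarrow> 'a \<Rightarrow> real) \<Rightarrow> 'a set set \<Rightarrow> (nat \<Rightarrow> 'a set) set" where
  "seqs_with_union_in X \<rho> F = {K \<in> topspace (seq_space X \<rho>). (\<Union>n. K n) \<in> F}"

definition KN_residual :: "'a set \<Rightarrow> ('a \<Rightarrow> 'a \<Rightarrow> real) \<Rightarrow> 'a set set \<Rightarrow> bool" where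
  "KN_residual X \<rho> F \<longleftrightarrow> residual_in (seq_space X \<rho>) (seqs_with_union_in X \<rho> F)"

definition KN_increasing_residual :: "'a set \<Rightarrow> ('a \<Rightarrow> 'a \<Rightarrow> real) \<Rightarrow> 'a set set \<Rightarrow> bool" where
  "KN_increasing_residual X \<rho> F \<longleftrightarrow>
     residual_in (increasing_seq_space X \<rho>) (seqs_with_union_in X \<rho> F \<inter> increasing_seqs X \<rho>)"

text \<open>\<open>Metric_space.mtopology\<close> is only meaningful for a metric, so we check that
  \<open>hausdorff_dist\<close> is one.\<close>

lemma SUP_INF_le_iff:
  fixes \<rho> :: "'a \<Rightarrow> 'a \<Rightarrow> real"
  assumes "A \<noteq> {}" "B \<noteq> {}"
    and nn: "\<And>x y. 0 \<le> \<rho> x y"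
    and le1: "\<And>x y. x \<in> A \<Longrightarrow> y \<in> B \<Longrightarrow> \<rho> x y \<le> 1"
  shows "(SUP a\<in>A. INF b\<in>B. \<rho> a b) \<le> r \<longleftrightarrow> (\<forall>a\<in>A. \<forall>e>0. \<exists>b\<in>B. \<rho> a b < r + e)"
proof -
  have bb: "bdd_below (\<rho> a ` B)" for a
    using nn by (auto intro: bdd_belowI[of _ 0])
  have "(INF b\<in>B. \<rho> a b) \<le> 1" if "a \<in> A" for a
    using \<open>B \<noteq> {}\<close> bb le1[OF that] by (meson cINF_lower2 ex_in_conv)
  then have ba: "bdd_above ((\<lambda>a. INF b\<in>B. \<rho> a b) ` A)"
    by (auto intro: bdd_aboveI[of _ 1])
  have "(INF b\<in>B. \<rho> a b) \<le> r \<longleftrightarrow> (\<forall>e>0. \<exists>b\<in>B. \<rho> a b < r + e)" for a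
  proof -
    have "(INF b\<in>B. \<rho> a b) \<le> r \<longleftrightarrow> (\<forall>e>0. (INF b\<in>B. \<rho> a b) < r + e)"
      by (metis add.commute field_le_epsilon less_add_same_cancel2 less_le_not_le nle_le order_le_less_trans)
    then show ?thesis
      using cINF_less_iff[OF \<open>B \<noteq> {}\<close> bb] by simp
  qed
  then show ?thesis
    using cSUP_le_iff[OF \<open>A \<noteq> {}\<close> ba] by simp
qed

lemma Metric_space_hausdorff_dist:
  assumes "Metric_space X \<rho>" and le1: "\<And>x y. x \<in> X \<Longrightarrow> y \<in> X \<Longrightarrow> \<rho> x y \<le> 1"
  shows "Metric_space (compact_subsets X \<rho>) (hausdorff_dist X \<rho>)"
proof -
  interpret Metric_space X \<rho> by fact
  let ?K = "compact_subsets X \<rho>" and ?d = "hausdorff_dist X \<rho>"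
  have sub: "A \<subseteq> X" if "A \<in> ?K" for A
    using that compactin_subset_topspace by (fastforce simp: compact_subsets_def)
  have clo: "closedin mtopology A" if "A \<in> ?K" for A
    using that Hausdorff_space_mtopology by (auto simp: compact_subsets_def intro: compactin_imp_closedin)
  have dle: "?d A B \<le> r \<longleftrightarrow> (\<forall>a\<in>A. \<forall>e>0. \<exists>b\<in>B. \<rho> a b < r + e) \<and> (\<forall>b\<in>B. \<forall>e>0. \<exists>a\<in>A. \<rho> a b < r + e)"
    if "A \<in> ?K" "B \<in> ?K" "A \<noteq> {}" "B \<noteq> {}" for A B r
  proof -
    have *: "\<rho> x y \<le> 1" if "x \<in> A" "y \<in> B" for x y
      using that sub \<open>A \<in> ?K\<close> \<open>B \<in> ?K\<close> le1 by blast
    show ?thesis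
      using that * SUP_INF_le_iff[of A B \<rho> r] SUP_INF_le_iff[of B A "\<lambda>x y. \<rho> y x" r]
      by (auto simp: hausdorff_dist_def)
  qed
  have nn: "0 \<le> ?d A B" for A B
  proof (cases "A \<in> ?K \<and> B \<in> ?K \<and> A \<noteq> {} \<and> B \<noteq> {}")
    case True
    show ?thesis
    proof (rule ccontr)
      assume "\<not> 0 \<le> ?d A B"
      moreover obtain a where "a \<in> A" using True by blast
      ultimately obtain b where "\<rho> a b < ?d A B + (- ?d A B)"
        using dle[of A B "?d A B"] True by (meson neg_0_less_iff_less not_le order_refl)
      then show False using nonneg[of a b] by linarith
    qed
  next
    case False
    then show ?thesis by (auto simp: hausdorff_dist_def)
  qed
  have d1: "?d A B \<le> 1" if "A \<in> ?K" "B \<in> ?K" for A B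
  proof (cases "A = {} \<or> B = {}")
    case False
    then obtain a0 b0 where ab: "a0 \<in> A" "b0 \<in> B" by blast
    have "\<rho> a b < 1 + e" if "a \<in> A" "b \<in> B" "e > 0" for a b and e :: real
      using le1[of a b] that sub[OF \<open>A \<in> ?K\<close>] sub[OF \<open>B \<in> ?K\<close>] by fastforce
    then show ?thesis
      using dle[of A B 1] that False ab by blast
  qed (auto simp: hausdorff_dist_def)
  show ?thesis
  proof
    show "0 \<le> ?d A B" for A B by (rule nn)
    show sym: "?d A B = ?d B A" for A B
      by (auto simp: hausdorff_dist_def max.commute commute)
    have half: "A \<subseteq> B" if "A \<in> ?K" "B \<in> ?K" "A \<noteq> {}" "B \<noteq> {}" "?d A B \<le> 0" for A B
    proof
      fix a assume "a \<in> A"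
      have "\<exists>b\<in>B. b \<in> mball a e" if "e > 0" for e
        using dle[of A B 0] \<open>a \<in> A\<close> that \<open>A \<in> ?K\<close> \<open>B \<in> ?K\<close> \<open>A \<noteq> {}\<close> \<open>B \<noteq> {}\<close> \<open>?d A B \<le> 0\<close> sub
        by (fastforce simp: subset_iff)
      then have "a \<in> mtopology closure_of B"
        using \<open>a \<in> A\<close> \<open>A \<in> ?K\<close> sub by (auto simp: metric_closure_of)
      then show "a \<in> B"
        using clo[OF \<open>B \<in> ?K\<close>] by (simp add: closure_of_closedin)
    qed
    show "?d A B = 0 \<longleftrightarrow> A = B" if K: "A \<in> ?K" "B \<in> ?K" for A B
    proof (cases "A = {} \<or> B = {}")
      case True
      then show ?thesis using K by (auto simp: hausdorff_dist_def)
    next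
      case False
      have "\<rho> a a < 0 + e" if "a \<in> A" "e > 0" for a and e :: real
        using that sub[OF K(1)] mdist_zero[of a] by auto
      then have "?d A A \<le> 0"
        using dle[of A A 0] K False by blast
      then show ?thesis
        using half[of A B] half[of B A] K False nn[of A A] sym[of A B] by auto
    qed
    show "?d A C \<le> ?d A B + ?d B C" if K: "A \<in> ?K" "B \<in> ?K" "C \<in> ?K" for A B C
    proof (cases "A = {} \<or> B = {} \<or> C = {}")
      case True
      have "A = {} \<Longrightarrow> ?thesis" "C = {} \<Longrightarrow> ?thesis"
        using K nn[of B C] nn[of A B] by (auto simp: hausdorff_dist_def split: if_splits)
      moreover have "?thesis" if "B = {}" "A \<noteq> {}" "C \<noteq> {}"
      proof -
        have "?d A B = 1" "?d B C = 1" using K that by (auto simp: hausdorff_dist_def)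
        then show ?thesis using d1[of A C] K by simp
      qed
      ultimately show ?thesis using True by blast
    next
      case False
      have AB: "(\<forall>a\<in>A. \<forall>e>0. \<exists>b\<in>B. \<rho> a b < ?d A B + e) \<and> (\<forall>b\<in>B. \<forall>e>0. \<exists>a\<in>A. \<rho> a b < ?d A B + e)"
        using dle[of A B "?d A B"] K False by simp
      have BC: "(\<forall>b\<in>B. \<forall>e>0. \<exists>c\<in>C. \<rho> b c < ?d B C + e) \<and> (\<forall>c\<in>C. \<forall>e>0. \<exists>b\<in>B. \<rho> b c < ?d B C + e)"
        using dle[of B C "?d B C"] K False by simp
      have tri: "\<rho> a c < ?d A B + ?d B C + e"
        if "a \<in> A" "b \<in> B" "c \<in> C" "\<rho> a b < ?d A B + e/2" "\<rho> b c < ?d B C + e/2" for a b c e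
        using triangle[of a b c] that K sub by (auto simp: subset_iff)
      have 1: "\<exists>c\<in>C. \<rho> a c < ?d A B + ?d B C + e" if ae: "a \<in> A" "e > 0" for a e
      proof -
        obtain b where "b \<in> B" "\<rho> a b < ?d A B + e/2"
          using AB ae by (meson half_gt_zero)
        moreover then obtain c where "c \<in> C" "\<rho> b c < ?d B C + e/2"
          using BC ae by (meson half_gt_zero)
        ultimately show ?thesis using tri ae by blast
      qed
      have 2: "\<exists>a\<in>A. \<rho> a c < ?d A B + ?d B C + e" if ae: "c \<in> C" "e > 0" for c e
      proof -
        obtain b where "b \<in> B" "\<rho> b c < ?d B C + e/2"
          using BC ae by (meson half_gt_zero)
        moreover then obtain a where "a \<in> A" "\<rho> a b < ?d A B + e/2"
          using AB ae by (meson half_gt_zero)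
        ultimately show ?thesis using tri ae by blast
      qed
      show ?thesis using 1 2 dle[of A C] K False by simp
    qed
  qed
qed

end

theory Submission
  imports Defs
begin

text \<open>
  Taking partial unions maps \<open>(K\<^sub>n)\<close> to an increasing sequence with the same union, but this map does not
  preserve category: for a generic increasing sequence \<open>L\<^sub>n\<close> is nowhere dense in \<open>L\<^sub>n\<^sub>+\<^sub>1\<close>, while a generic
  \<open>(K\<^sub>n)\<close> is pairwise disjoint. Instead, a generic \<open>K\<close> and a generic \<open>L\<close> with the same union are built
  simultaneously. A finite approximation (a state) is a finite separated set of points with a radius, each
  point carrying an index \<open>j\<close> with \<open>x \<in> K\<^sub>j\<close> and the first index \<open>i\<close> with \<open>x \<in> L\<^sub>i\<close>; it determines a basic open
  set in either sequence space. Every state can be refined into any nonempty open subset of either of these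
  two sets (for \<open>K\<close> this requires making finite sets disjoint, hence that there are no isolated points),
  and the sequences determined by an infinite chain of refinements have equal unions. Steering one
  coordinate into given dense open sets therefore transfers residuality to the other coordinate.
\<close>

section \<open>Residual sets\<close>

lemma dense_open_complement_imp_nowhere_dense_in:
  assumes D: "openin T D" "T closure_of D = topspace T" and S: "S \<subseteq> topspace T - D"
  shows "nowhere_dense_in T S"
proof -
  have "T closure_of S \<subseteq> topspace T - D"
    using S D(1) by (simp add: closure_of_minimal openin_closedin_eq)
  then have "T interior_of (T closure_of S) \<subseteq> topspace T - T closure_of D"
    by (metis interior_of_complement interior_of_mono)
  then show ?thesis
    using S D(2) by (auto simp: nowhere_dense_in_def)
qed

text \<open>Complements of closures of nowhere dense sets are dense and open, and complements of
  dense open sets are nowhere dense; this form is the one suited to steering a sequence of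
  refinements.\<close>

lemma residual_in_iff_dense_open:
  "residual_in T S \<longleftrightarrow> S \<subseteq> topspace T \<and>
     (\<exists>D :: nat \<Rightarrow> 'a set. (\<forall>n. openin T (D n) \<and> T closure_of D n = topspace T) \<and> (\<Inter>n. D n) \<subseteq> S)"
  (is "_ \<longleftrightarrow> _ \<and> ?R")
proof -
  have ?R if m: "meagre_in T (topspace T - S)" and "S \<subseteq> topspace T"
  proof -
    obtain \<U> where U: "countable \<U>" "\<U> \<subseteq> Collect (nowhere_dense_in T)" "\<Union>\<U> = topspace T - S"
      using m by (auto simp: meagre_in_def union_of_def)
    \<comment> \<open>Inserting the empty set, itself nowhere dense, keeps the family nonempty, so
      that \<open>from_nat_into\<close> enumerates it even when \<open>\<U>\<close> is
      empty.\<close>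
    define D where "D = (\<lambda>n. topspace T - T closure_of (from_nat_into (insert {} \<U>) n))"
    have nd: "nowhere_dense_in T (from_nat_into (insert {} \<U>) n)" for n
    proof -
      have "from_nat_into (insert {} \<U>) n \<in> insert {} \<U>" by (rule from_nat_into) simp
      moreover have "nowhere_dense_in T {}" by (simp add: nowhere_dense_in_def)
      ultimately show ?thesis using U(2) by (metis insertE mem_Collect_eq subsetD)
    qed
    have "openin T (D n) \<and> T closure_of D n = topspace T" for n
      using nd[of n] by (auto simp: D_def nowhere_dense_in_def closure_of_complement)
    moreover have "(\<Inter>n. D n) \<subseteq> S"
    proof
      fix x assume x: "x \<in> (\<Inter>n. D n)"
      show "x \<in> S"
      proof (rule ccontr)
        assume "x \<notin> S"
        moreover have "x \<in> topspace T" using x by (auto simp: D_def)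
        ultimately obtain V where V: "V \<in> \<U>" "x \<in> V" using U(3) by blast
        then obtain n where n: "from_nat_into (insert {} \<U>) n = V"
          using U(1) by (metis countable_insert from_nat_into_surj insertI2)
        have "nowhere_dense_in T V" using V U(2) by blast
        then have "x \<in> T closure_of V"
          using V(2) closure_of_subset[of V T] by (auto simp: nowhere_dense_in_def)
        then show False using x n by (auto simp: D_def)
      qed
    qed
    ultimately show ?R by blast
  qed
  moreover have "meagre_in T (topspace T - S)" if ?R
  proof -
    obtain D :: "nat \<Rightarrow> 'a set" where D: "\<And>n. openin T (D n)" "\<And>n. T closure_of D n = topspace T"
      and sub: "(\<Inter>n. D n) \<subseteq> S"
      using \<open>?R\<close> by blast
    have "nowhere_dense_in T (topspace T - S - D n)" for n
      using D by (blast intro: dense_open_complement_imp_nowhere_dense_in)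
    moreover have "(\<Union>n. topspace T - S - D n) = topspace T - S"
      using sub by blast
    ultimately show ?thesis
      unfolding meagre_in_def union_of_def
      by (intro exI[of _ "range (\<lambda>n. topspace T - S - D n)"]) auto
  qed
  ultimately show ?thesis
    by (auto simp: residual_in_def)
qed

text \<open>Zorn's lemma applies because pairwise disjointness survives unions of chains.
  Disjointness later makes branches unique, maximality makes the union of the chosen sets
  dense.\<close>

lemma maximal_disjoint_subfamily:
  fixes U :: "'s \<Rightarrow> 'y set"
  obtains M where "M \<subseteq> P" "pairwise (\<lambda>a b. disjnt (U a) (U b)) M"
    "\<And>s. s \<in> P \<Longrightarrow> U s \<noteq> {} \<Longrightarrow> \<exists>t\<in>M. \<not> disjnt (U s) (U t)"
proof -
  let ?A = "{M. M \<subseteq> P \<and> pairwise (\<lambda>a b. disjnt (U a) (U b)) M}"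
  have "\<exists>M\<in>?A. \<forall>N\<in>?A. M \<subseteq> N \<longrightarrow> N = M"
  proof (rule subset_Zorn')
    fix C assume C: "subset.chain ?A C"
    have "pairwise (\<lambda>a b. disjnt (U a) (U b)) (\<Union>C)"
      unfolding pairwise_def
    proof (intro ballI impI)
      fix a b assume "a \<in> \<Union>C" "b \<in> \<Union>C" "a \<noteq> b"
      then obtain N1 N2 where N: "N1 \<in> C" "a \<in> N1" "N2 \<in> C" "b \<in> N2" by blast
      then have "N1 \<subseteq> N2 \<or> N2 \<subseteq> N1" using C unfolding subset_chain_def by blast
      then obtain N where "N \<in> C" "a \<in> N" "b \<in> N" using N by blast
      then show "disjnt (U a) (U b)"
        using C \<open>a \<noteq> b\<close> by (auto simp: subset_chain_def pairwise_def)
    qed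
    then show "\<Union>C \<in> ?A" using C by (auto simp: subset_chain_def)
  qed
  then obtain M where "M \<in> ?A" and max: "\<And>N. N \<in> ?A \<Longrightarrow> M \<subseteq> N \<Longrightarrow> N = M"
    by (elim bexE) simp
  then have M: "M \<subseteq> P" "pairwise (\<lambda>a b. disjnt (U a) (U b)) M" by simp_all
  have "\<exists>t\<in>M. \<not> disjnt (U s) (U t)" if "s \<in> P" "U s \<noteq> {}" for s
  proof (rule ccontr)
    assume "\<not> ?thesis"
    then have dis: "\<forall>t\<in>M. disjnt (U s) (U t)" by blast
    \<comment> \<open>By maximality \<open>s\<close> already belongs to \<open>M\<close>, so
      \<open>U s\<close> would be disjoint from itself, hence empty.\<close>
    then have "insert s M = M"
      using M that by (intro max) (auto simp: pairwise_insert disjnt_sym)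
    then show False using dis that by (auto simp: disjnt_def)
  qed
  then show thesis using that M by blast
qed

text \<open>A Banach-Mazur argument: maximal disjoint families of states assign to a generic \<open>y\<close> a unique
  branch of states, along which \<open>V\<close> is steered into the prescribed dense open sets. No Baire property
  of \<open>A\<close> is needed.\<close>
lemma residual_in_transfer:
  fixes R :: "'s \<Rightarrow> 's \<Rightarrow> bool" and U :: "'s \<Rightarrow> 'y set" and V :: "'s \<Rightarrow> 'z set"
  assumes B: "residual_in TZ B" and A: "A \<subseteq> topspace TY"
    and init: "U s0 = topspace TY" "valid s0"
    and openU: "\<And>s. valid s \<Longrightarrow> openin TY (U s)"
    and openV: "\<And>s. valid s \<Longrightarrow> openin TZ (V s)"
    and neU: "\<And>s. valid s \<Longrightarrow> U s \<noteq> {}"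
    and neV: "\<And>s. valid s \<Longrightarrow> V s \<noteq> {}"
    and R: "\<And>s t. valid s \<Longrightarrow> R s t \<Longrightarrow> valid t \<and> U t \<subseteq> U s"
    and trans: "\<And>s t u. valid s \<Longrightarrow> R s t \<Longrightarrow> R t u \<Longrightarrow> R s u"
    and extU: "\<And>s W. valid s \<Longrightarrow> openin TY W \<Longrightarrow> W \<noteq> {} \<Longrightarrow> W \<subseteq> U s \<Longrightarrow> \<exists>t. R s t \<and> U t \<subseteq> W"
    and extV: "\<And>s W. valid s \<Longrightarrow> openin TZ W \<Longrightarrow> W \<noteq> {} \<Longrightarrow> W \<subseteq> V s \<Longrightarrow> \<exists>t. R s t \<and> V t \<subseteq> W"
    and lim: "\<And>s y. (\<And>n. valid (s n)) \<Longrightarrow> (\<And>n. R (s n) (s (Suc n))) \<Longrightarrow> (\<And>n. y \<in> U (s n)) \<Longrightarrow>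
                \<exists>z. (\<forall>n. z \<in> V (s n)) \<and> (z \<in> B \<longrightarrow> y \<in> A)"
  shows "residual_in TY A"
proof -
  obtain D :: "nat \<Rightarrow> 'z set" where D: "\<And>n. openin TZ (D n)" "\<And>n. TZ closure_of D n = topspace TZ"
    and DB: "(\<Inter>n. D n) \<subseteq> B"
    using B by (auto simp: residual_in_iff_dense_open)
  \<comment> \<open>Candidates for round \<open>n\<close>: refinements of \<open>s\<close> whose
    \<open>V\<close> side has entered the dense open set \<open>D n\<close>.\<close>
  define Q where "Q = (\<lambda>n s. {t. R s t \<and> V t \<subseteq> D n})"
  have "\<forall>n s. \<exists>M. M \<subseteq> Q n s \<and> pairwise (\<lambda>a b. disjnt (U a) (U b)) M \<and>
      (\<forall>t\<in>Q n s. U t \<noteq> {} \<longrightarrow> (\<exists>t'\<in>M. \<not> disjnt (U t) (U t')))"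
  proof (intro allI)
    fix n s
    show "\<exists>M. M \<subseteq> Q n s \<and> pairwise (\<lambda>a b. disjnt (U a) (U b)) M \<and>
      (\<forall>t\<in>Q n s. U t \<noteq> {} \<longrightarrow> (\<exists>t'\<in>M. \<not> disjnt (U t) (U t')))"
      by (rule maximal_disjoint_subfamily[of "Q n s" U]) blast
  qed
  then obtain M where MQ: "\<And>n s. M n s \<subseteq> Q n s"
    and Mdis: "\<And>n s. pairwise (\<lambda>a b. disjnt (U a) (U b)) (M n s)"
    and Mmax: "\<And>n s t. t \<in> Q n s \<Longrightarrow> U t \<noteq> {} \<Longrightarrow> \<exists>t'\<in>M n s. \<not> disjnt (U t) (U t')"
    by metis
  have MR: "R s t \<and> valid t \<and> U t \<subseteq> U s \<and> V t \<subseteq> D n" if "valid s" "t \<in> M n s" for n s t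
    using that MQ[of n s] R[of s t] unfolding Q_def by blast
  \<comment> \<open>The states reachable in \<open>n\<close> rounds when each state \<open>s\<close>
    passes only to members of its maximal disjoint family \<open>M n s\<close>.\<close>
  define \<S> where "\<S> = rec_nat {s0} (\<lambda>n X. \<Union>s\<in>X. M n s)"
  have S0: "\<S> 0 = {s0}" and SS: "\<S> (Suc n) = (\<Union>s\<in>\<S> n. M n s)" for n
    by (auto simp: \<S>_def)
  have val: "\<forall>s\<in>\<S> n. valid s" for n
  proof (induction n)
    case (Suc n)
    then show ?case using MR unfolding SS by blast
  qed (simp add: S0 init)
  have dis: "pairwise (\<lambda>a b. disjnt (U a) (U b)) (\<S> n)" for n
  proof (induction n)
    case (Suc n)
    show ?case unfolding pairwise_def
    proof (intro ballI impI)
      fix a b assume ab: "a \<in> \<S> (Suc n)" "b \<in> \<S> (Suc n)" "a \<noteq> b"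
      then obtain s t where st: "s \<in> \<S> n" "a \<in> M n s" "t \<in> \<S> n" "b \<in> M n t" by (auto simp: SS)
      then have "U a \<subseteq> U s" "U b \<subseteq> U t" using MR val by blast+
      moreover have "disjnt (U a) (U b)" if "s = t"
        using st Mdis[of n s] ab(3) that by (blast dest: pairwiseD)
      moreover have "disjnt (U s) (U t)" if "s \<noteq> t"
        using st Suc that by (blast dest: pairwiseD)
      ultimately show "disjnt (U a) (U b)"
        by (metis disjnt_subset1 disjnt_subset2)
    qed
  qed (simp add: S0)
  define E where "E = (\<lambda>n. \<Union>s\<in>\<S> n. U s)"
  have Eopen: "openin TY (E n)" for n
    using val openU by (auto simp: E_def)
  \<comment> \<open>Density of \<open>E n\<close> by induction: a state of the previous round whose
    \<open>U\<close> meets \<open>W\<close> is refined first into \<open>W\<close> by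
    \<open>extU\<close>, then into \<open>D n\<close> by \<open>extV\<close>. By
    \<open>trans\<close> the result is a candidate in \<open>Q n s\<close>, so maximality yields a
    chosen state meeting it.\<close>
  have meets: "W \<inter> E n \<noteq> {}" if "openin TY W" "W \<noteq> {}" for W n
    using that
  proof (induction n arbitrary: W)
    case 0
    then show ?case using openin_subset by (fastforce simp: E_def S0 init)
  next
    case (Suc n)
    then obtain s where s: "s \<in> \<S> n" "W \<inter> U s \<noteq> {}" by (fastforce simp: E_def)
    then have vs: "valid s" using val by blast
    then obtain s1 where s1: "R s s1" "U s1 \<subseteq> W \<inter> U s"
      using extU[of s "W \<inter> U s"] s Suc.prems openU by (metis inf_le2 openin_Int)
    then have vs1: "valid s1" using R vs by blast
    have "D n \<inter> V s1 \<noteq> {}"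
      using D openV[OF vs1] neV[OF vs1] by (metis dense_intersects_open)
    then obtain s2 where s2: "R s1 s2" "V s2 \<subseteq> D n \<inter> V s1"
      using extV[of s1 "D n \<inter> V s1"] vs1 D(1) openV by (metis inf_le2 openin_Int)
    have "valid s2" "U s2 \<subseteq> U s1" using R vs1 s2 by auto
    moreover have "s2 \<in> Q n s" using trans vs s1 s2 by (auto simp: Q_def)
    ultimately obtain t where "t \<in> M n s" "\<not> disjnt (U s2) (U t)"
      using Mmax neU by blast
    moreover have "t \<in> \<S> (Suc n)" using s(1) \<open>t \<in> M n s\<close> by (auto simp: SS)
    ultimately show ?case
      using s1(2) \<open>U s2 \<subseteq> U s1\<close> unfolding E_def disjnt_def by blast
  qed
  have "y \<in> A" if y: "y \<in> (\<Inter>n. E n)" for y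
  proof -
    obtain s where s: "\<And>n. s n \<in> \<S> n" "\<And>n. y \<in> U (s n)"
      using y unfolding E_def by (simp add: Bex_def) metis
    \<comment> \<open>The state holding \<open>y\<close> in round \<open>Suc n\<close> descends from
      a state that also holds \<open>y\<close>; disjointness identifies the latter with
      \<open>s n\<close>, so the separate choices form one branch.\<close>
    have sM: "s (Suc n) \<in> M n (s n)" for n
    proof -
      obtain t where t: "t \<in> \<S> n" "s (Suc n) \<in> M n t" using s(1)[of "Suc n"] by (auto simp: SS)
      then have "y \<in> U t" using MR val s(2)[of "Suc n"] by blast
      then have "t = s n" using dis[of n] s[of n] t by (auto simp: pairwise_def disjnt_def)
      then show ?thesis using t by simp
    qed
    then have "R (s n) (s (Suc n))" "V (s (Suc n)) \<subseteq> D n" for n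
      using MR val s(1) by blast+
    moreover obtain z where z: "\<forall>n. z \<in> V (s n)" "z \<in> B \<longrightarrow> y \<in> A"
      using lim[of s y] val s calculation by blast
    ultimately have "z \<in> (\<Inter>n. D n)" by blast
    then show ?thesis using z DB by blast
  qed
  moreover have "TY closure_of E n = topspace TY" for n
    unfolding dense_intersects_open using meets by (metis Int_commute)
  ultimately show ?thesis
    unfolding residual_in_iff_dense_open using A Eopen by (intro conjI exI[of _ E]) auto
qed

section \<open>The hyperspace and the sequence spaces\<close>

lemma finite_positive_lower_bound:
  fixes S :: "real set"
  assumes "finite S" "\<And>x. x \<in> S \<Longrightarrow> 0 < x"
  shows "\<exists>d>0. \<forall>x\<in>S. d \<le> x"
proof (intro exI conjI ballI)
  show "0 < Min (insert 1 S)" using assms by (subst Min_gr_iff) auto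
  show "Min (insert 1 S) \<le> x" if "x \<in> S" for x using assms(1) that by (intro Min_le) auto
qed

locale bounded_compact_metric = Metric_space X \<rho> for X :: "'a set" and \<rho> +
  assumes compact: "compact_space mtopology"
    and le1: "\<And>x y. x \<in> X \<Longrightarrow> y \<in> X \<Longrightarrow> \<rho> x y \<le> 1"
begin

text \<open>A strict, pointwise form of small Hausdorff distance. Only the empty set is near the
  empty set, in agreement with the distance 1 as long as \<open>e \<le> 1\<close>.\<close>

definition near :: "real \<Rightarrow> 'a set \<Rightarrow> 'a set \<Rightarrow> bool" where
  "near e A B \<longleftrightarrow> (\<forall>a\<in>A. \<exists>b\<in>B. \<rho> a b < e) \<and> (\<forall>b\<in>B. \<exists>a\<in>A. \<rho> a b < e)"

lemma compact_subsets_iff: "A \<in> compact_subsets X \<rho> \<longleftrightarrow> closedin mtopology A"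
  using compact Hausdorff_space_mtopology
  by (auto simp: compact_subsets_def closedin_compact_space intro: compactin_imp_closedin)

lemma compact_subsets_subset: "A \<in> compact_subsets X \<rho> \<Longrightarrow> A \<subseteq> X"
  using closedin_subset by (fastforce simp: compact_subsets_iff)

lemma finite_in_compact_subsets: "finite A \<Longrightarrow> A \<subseteq> X \<Longrightarrow> A \<in> compact_subsets X \<rho>"
  by (simp add: compact_subsets_def finite_imp_compactin)

lemma near_refl: "A \<subseteq> X \<Longrightarrow> e > 0 \<Longrightarrow> near e A A"
  using mdist_zero by (force simp: near_def)

lemma near_trans:
  assumes "near e A B" "near f B C" "A \<subseteq> X" "B \<subseteq> X" "C \<subseteq> X"
  shows "near (e + f) A C"
proof -
  have 1: "\<rho> a c < e + f" if "\<rho> a b < e" "\<rho> b c < f" "a \<in> A" "b \<in> B" "c \<in> C" for a b c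
    using triangle[of a b c] that assms(3-5) by (auto simp: subset_iff)
  show ?thesis
    unfolding near_def
  proof (intro conjI ballI)
    fix a assume "a \<in> A"
    then obtain b where "b \<in> B" "\<rho> a b < e" using assms(1) by (auto simp: near_def)
    then obtain c where "c \<in> C" "\<rho> b c < f" using assms(2) by (auto simp: near_def)
    then show "\<exists>c\<in>C. \<rho> a c < e + f" using 1 \<open>a \<in> A\<close> \<open>b \<in> B\<close> \<open>\<rho> a b < e\<close> by blast
  next
    fix c assume "c \<in> C"
    then obtain b where "b \<in> B" "\<rho> b c < f" using assms(2) by (auto simp: near_def)
    then obtain a where "a \<in> A" "\<rho> a b < e" using assms(1) by (auto simp: near_def)
    then show "\<exists>a\<in>A. \<rho> a c < e + f" using 1 \<open>c \<in> C\<close> \<open>b \<in> B\<close> \<open>\<rho> b c < f\<close> by blast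
  qed
qed

lemma near_mono: "near e A B \<Longrightarrow> e \<le> f \<Longrightarrow> near f A B"
  unfolding near_def by (meson less_le_trans)

lemma hausdorff_dist_le_iff:
  assumes "A \<in> compact_subsets X \<rho>" "B \<in> compact_subsets X \<rho>" "A \<noteq> {}" "B \<noteq> {}"
  shows "hausdorff_dist X \<rho> A B \<le> r \<longleftrightarrow> (\<forall>e>0. near (r + e) A B)"
proof -
  have "\<rho> x y \<le> 1" if "x \<in> A" "y \<in> B" for x y
    using that assms le1 compact_subsets_subset by blast
  then show ?thesis
    using assms SUP_INF_le_iff[of A B \<rho> r] SUP_INF_le_iff[of B A "\<lambda>x y. \<rho> y x" r]
    by (auto simp: hausdorff_dist_def near_def)
qed

lemma near_imp_hausdorff_dist_le:
  assumes "A \<in> compact_subsets X \<rho>" "B \<in> compact_subsets X \<rho>" "near e A B" "0 \<le> e"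
  shows "hausdorff_dist X \<rho> A B \<le> e"
proof (cases "A = {} \<or> B = {}")
  case True
  then have "A = {} \<and> B = {}" using assms(3) by (auto simp: near_def)
  then show ?thesis using assms by (simp add: hausdorff_dist_def)
next
  case False
  then show ?thesis using assms hausdorff_dist_le_iff near_mono by (simp add: less_imp_le)
qed

text \<open>The bound \<open>e \<le> 1\<close> excludes that exactly one of the two sets is empty,
  since their distance would be 1.\<close>

lemma hausdorff_dist_less_imp_near:
  assumes K: "A \<in> compact_subsets X \<rho>" "B \<in> compact_subsets X \<rho>"
    and "hausdorff_dist X \<rho> A B < e" "e \<le> 1"
  shows "near e A B"
proof (cases "A = {} \<or> B = {}")
  case True
  then have "A = {} \<and> B = {}" using assms by (auto simp: hausdorff_dist_def split: if_splits)
  then show ?thesis by (simp add: near_def)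
next
  case False
  then have "near (hausdorff_dist X \<rho> A B + d) A B" if "d > 0" for d
    using hausdorff_dist_le_iff[OF K, of "hausdorff_dist X \<rho> A B"] that by simp
  from this[of "e - hausdorff_dist X \<rho> A B"] show ?thesis using assms(3) by simp
qed

sublocale hyp: Metric_space "compact_subsets X \<rho>" "hausdorff_dist X \<rho>"
  by (rule Metric_space_hausdorff_dist) (use Metric_space_axioms le1 in auto)

lemma topspace_hyperspace [simp]: "topspace (hyperspace X \<rho>) = compact_subsets X \<rho>"
  by (simp add: hyperspace_def)

text \<open>Two kinds of slack are needed: the strict inequalities at the finitely many points of
  \<open>B\<close> leave a positive margin, and the cover of the compact set \<open>A\<close> by
  balls about \<open>B\<close> has a Lebesgue number.\<close>

lemma openin_hyperspace_near:
  assumes "finite B" "B \<subseteq> X"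
  shows "openin (hyperspace X \<rho>) {A \<in> compact_subsets X \<rho>. near r B A}"
  unfolding hyperspace_def hyp.openin_mtopology
proof (intro conjI allI impI)
  fix A assume "A \<in> {A \<in> compact_subsets X \<rho>. near r B A}"
  then have A: "A \<in> compact_subsets X \<rho>" "near r B A" by auto
  have AX: "A \<subseteq> X" using A(1) by (rule compact_subsets_subset)
  obtain f where f: "\<And>b. b \<in> B \<Longrightarrow> f b \<in> A \<and> \<rho> b (f b) < r"
    using A(2) unfolding near_def by metis
  have "A \<subseteq> \<Union>((\<lambda>b. mball b r) ` B)"
    using A(2) AX assms(2) by (fastforce simp: near_def subset_iff)
  moreover have "openin mtopology W" if "W \<in> (\<lambda>b. mball b r) ` B" for W
    using that by auto
  ultimately have "\<exists>e>0. \<forall>a\<in>A. \<exists>W\<in>(\<lambda>b. mball b r) ` B. mball a e \<subseteq> W"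
    using A(1) by (intro lebesgue_number) (auto simp: compact_subsets_def)
  then obtain e where e: "e > 0" "\<And>a. a \<in> A \<Longrightarrow> \<exists>b\<in>B. mball a e \<subseteq> mball b r"
    by auto
  have "\<exists>d>0. \<forall>x\<in>{e, 1} \<union> (\<lambda>b. r - \<rho> b (f b)) ` B. d \<le> x"
    by (rule finite_positive_lower_bound) (use assms(1) e(1) f in auto)
  \<comment> \<open>The bound \<open>e\<close> is the Lebesgue number and controls the points of
    \<open>A'\<close>; the margins control the points of \<open>B\<close>; the bound 1 allows
    passing from Hausdorff distance to \<open>near\<close>.\<close>
  then obtain d where d: "0 < d" "d \<le> e" "d \<le> 1" "\<And>b. b \<in> B \<Longrightarrow> d \<le> r - \<rho> b (f b)"
    by auto
  have "near r B A'" if "A' \<in> hyp.mball A d" for A'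
  proof -
    have A': "A' \<in> compact_subsets X \<rho>" "near d A A'"
      using that d hausdorff_dist_less_imp_near by auto
    have A'X: "A' \<subseteq> X" using A'(1) by (rule compact_subsets_subset)
    show ?thesis unfolding near_def
    proof (intro conjI ballI)
      fix b assume b: "b \<in> B"
      then obtain a where a: "a \<in> A'" "\<rho> (f b) a < d" using f[OF b] A'(2) unfolding near_def by blast
      then have "\<rho> b a < r"
        using triangle[of b "f b" a] b f[OF b] d(4)[OF b] assms(2) AX A'X by (auto simp: subset_iff)
      then show "\<exists>a\<in>A'. \<rho> b a < r" using a by blast
    next
      fix a assume a: "a \<in> A'"
      then obtain a0 where a0: "a0 \<in> A" "\<rho> a0 a < d" using A'(2) by (auto simp: near_def)
      then obtain b where "b \<in> B" "mball a0 e \<subseteq> mball b r" using e by blast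
      moreover have "a \<in> mball a0 e" using a0 a d(2) AX A'X by auto
      ultimately have "a \<in> mball b r" by blast
      then show "\<exists>b\<in>B. \<rho> b a < r" using \<open>b \<in> B\<close> by auto
    qed
  qed
  then show "\<exists>r'>0. hyp.mball A r' \<subseteq> {A \<in> compact_subsets X \<rho>. near r B A}"
    using d(1) by (intro exI[of _ d]) auto
qed auto

lemma openin_hyperspace_imp_near:
  assumes "openin (hyperspace X \<rho>) W" "A \<in> W"
  obtains e where "e > 0" "\<And>A'. A' \<in> compact_subsets X \<rho> \<Longrightarrow> near e A A' \<Longrightarrow> A' \<in> W"
proof -
  obtain r where r: "r > 0" "hyp.mball A r \<subseteq> W" and W: "W \<subseteq> compact_subsets X \<rho>"
    using assms by (auto simp: hyperspace_def hyp.openin_mtopology)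
  \<comment> \<open>Being near within \<open>r/2\<close> bounds the distance only weakly by
    \<open>r/2\<close>; halving restores a strict bound by \<open>r\<close>.\<close>
  have "A' \<in> W" if "A' \<in> compact_subsets X \<rho>" "near (r/2) A A'" for A'
  proof -
    have "A \<in> compact_subsets X \<rho>" using W assms(2) by blast
    moreover from this have "hausdorff_dist X \<rho> A A' < r"
      using near_imp_hausdorff_dist_le[OF _ that] r by fastforce
    ultimately have "A' \<in> hyp.mball A r" using that(1) by simp
    then show ?thesis using r by blast
  qed
  then show thesis using that[of "r/2"] r by simp
qed

section \<open>Basic neighbourhoods in the sequence spaces\<close>

lemma topspace_seq_space [simp]: "topspace (seq_space X \<rho>) = {K. \<forall>n. K n \<in> compact_subsets X \<rho>}"
  by (auto simp: seq_space_def)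

lemma topspace_increasing_seq_space [simp]:
  "topspace (increasing_seq_space X \<rho>) = increasing_seqs X \<rho>"
  by (auto simp: increasing_seq_space_def increasing_seqs_def)

lemma openin_seq_space_near:
  assumes "\<And>n. finite (B n)" "\<And>n. B n \<subseteq> X"
  shows "openin (seq_space X \<rho>) {K \<in> topspace (seq_space X \<rho>). \<forall>n<m. near r (B n) (K n)}"
proof -
  let ?U = "\<lambda>n. if n < m then {A \<in> compact_subsets X \<rho>. near r (B n) A} else compact_subsets X \<rho>"
  have "openin (seq_space X \<rho>) (Pi\<^sub>E UNIV ?U)"
    unfolding seq_space_def
  proof (rule product_topology_basis)
    show "openin (hyperspace X \<rho>) (?U n)" for n
      using openin_hyperspace_near assms openin_topspace[of "hyperspace X \<rho>"] by simp
    show "finite {n. ?U n \<noteq> topspace (hyperspace X \<rho>)}"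
      by (rule finite_subset[of _ "{..<m}"]) auto
  qed
  moreover have "Pi\<^sub>E UNIV ?U = {K \<in> topspace (seq_space X \<rho>). \<forall>n<m. near r (B n) (K n)}"
    by (auto simp: PiE_iff split: if_splits)
  ultimately show ?thesis by simp
qed

lemma openin_seq_space_imp_near:
  assumes "openin (seq_space X \<rho>) W" "K \<in> W"
  obtains m e where "e > 0"
    "\<And>K'. K' \<in> topspace (seq_space X \<rho>) \<Longrightarrow> (\<And>n. n < m \<Longrightarrow> near e (K n) (K' n)) \<Longrightarrow> K' \<in> W"
proof -
  obtain U where U: "finite {n. U n \<noteq> compact_subsets X \<rho>}" "\<And>n. openin (hyperspace X \<rho>) (U n)"
    "K \<in> Pi\<^sub>E UNIV U" "Pi\<^sub>E UNIV U \<subseteq> W"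
    using assms unfolding seq_space_def openin_product_topology_alt by fastforce
  obtain m where m: "{n. U n \<noteq> compact_subsets X \<rho>} \<subseteq> {..<m}"
    using U(1) finite_nat_iff_bounded by blast
  have "\<exists>e>0. \<forall>A'\<in>compact_subsets X \<rho>. near e (K n) A' \<longrightarrow> A' \<in> U n" for n
    using openin_hyperspace_imp_near[OF U(2), of "K n" n] U(3) by (metis PiE_E UNIV_I)
  then obtain f where f: "\<And>n. f n > 0" "\<And>n A'. A' \<in> compact_subsets X \<rho> \<Longrightarrow> near (f n) (K n) A' \<Longrightarrow> A' \<in> U n"
    by metis
  have "\<exists>e>0. \<forall>x\<in>f ` {..<m}. e \<le> x"
    by (rule finite_positive_lower_bound) (use f(1) in auto)
  then obtain e where e: "e > 0" "\<And>n. n < m \<Longrightarrow> e \<le> f n" by auto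
  have "K' \<in> W" if K': "K' \<in> topspace (seq_space X \<rho>)" "\<And>n. n < m \<Longrightarrow> near e (K n) (K' n)" for K'
  proof -
    have "K' n \<in> U n" for n
    proof (cases "n < m")
      case True
      have "near (f n) (K n) (K' n)" using K'(2)[OF True] e(2)[OF True] by (rule near_mono)
      then show ?thesis using f(2) K'(1) by simp
    next
      case False
      then have "U n = compact_subsets X \<rho>" using m by auto
      then show ?thesis using K'(1) by simp
    qed
    then show ?thesis using U(4) by auto
  qed
  then show thesis using that[of e m] e(1) by blast
qed

section \<open>Finite approximations of compact sets and their limits\<close>

lemma finite_near_subset:
  assumes "A \<in> compact_subsets X \<rho>" "e > 0"
  shows "\<exists>C. finite C \<and> C \<subseteq> A \<and> near e A C"
proof -
  have "mtotally_bounded A"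
    using assms by (auto simp: compact_subsets_def intro: compactin_imp_mtotally_bounded)
  then have "\<exists>C. finite C \<and> C \<subseteq> A \<and> A \<subseteq> (\<Union>x\<in>C. mball x e)"
    using assms(2) by (simp add: mtotally_bounded_def)
  then obtain C where C: "finite C" "C \<subseteq> A" "A \<subseteq> (\<Union>x\<in>C. mball x e)"
    by (elim exE conjE)
  have "near e A C" unfolding near_def
  proof (intro conjI ballI)
    show "\<exists>b\<in>C. \<rho> a b < e" if a: "a \<in> A" for a
    proof -
      obtain b where "b \<in> C" "a \<in> mball b e" using C(3) a by blast
      then show ?thesis by (metis commute in_mball)
    qed
    show "\<exists>a\<in>A. \<rho> a b < e" if "b \<in> C" for b
    proof -
      have "b \<in> A" "b \<in> X" using that C(2) compact_subsets_subset[OF assms(1)] by auto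
      then show ?thesis using assms(2) by (intro bexI[of _ b]) auto
    qed
  qed
  then show ?thesis using C(1,2) by (intro exI conjI)
qed

lemma in_compact_subset_if_near:
  assumes "A \<in> compact_subsets X \<rho>" "p \<in> X" "\<And>e. e > 0 \<Longrightarrow> \<exists>a\<in>A. \<rho> p a < e"
  shows "p \<in> A"
proof -
  have "p \<in> mtopology closure_of A"
    using assms compact_subsets_subset[OF assms(1)] by (fastforce simp: metric_closure_of)
  then show ?thesis using assms(1) by (simp add: compact_subsets_iff closure_of_closedin)
qed

text \<open>The closed balls about \<open>G n\<close> shrink in a nested way: every ball sits inside
  one of the previous stage and contains one of the next. Their common part is closed, and
  compactness puts a point of it near every center. The start \<open>N\<close> is the stage from
  which a given index is constrained.\<close>

lemma near_limit:
  fixes G :: "nat \<Rightarrow> 'a set" and r :: "nat \<Rightarrow> real" and N :: nat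
  defines "A \<equiv> {p \<in> X. \<forall>n\<ge>N. \<exists>x\<in>G n. \<rho> x p \<le> r n}"
  assumes fin: "\<And>n. finite (G n)" and GX: "\<And>n. G n \<subseteq> X" and r0: "\<And>n. r n > 0"
    and parent: "\<And>n y. N \<le> n \<Longrightarrow> y \<in> G (Suc n) \<Longrightarrow> \<exists>x\<in>G n. \<rho> x y + r (Suc n) < r n"
    and child: "\<And>n x. N \<le> n \<Longrightarrow> x \<in> G n \<Longrightarrow> \<exists>y\<in>G (Suc n). \<rho> x y + r (Suc n) < r n"
  shows "A \<in> compact_subsets X \<rho>" and "\<And>n. N \<le> n \<Longrightarrow> near (r n) (G n) A"
proof -
  define C where "C = (\<lambda>n. \<Union>x\<in>G n. mcball x (r n))"
  have Ceq: "p \<in> C n \<longleftrightarrow> p \<in> X \<and> (\<exists>x\<in>G n. \<rho> x p \<le> r n)" for n p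
    using GX by (auto simp: C_def)
  have "closedin mtopology (\<Inter>n\<in>{N..}. C n)"
    using fin by (intro closedin_INT) (auto simp: C_def intro!: closedin_Union)
  moreover have "A = (\<Inter>n\<in>{N..}. C n)"
    by (auto simp: A_def Ceq)
  ultimately show "A \<in> compact_subsets X \<rho>" by (simp add: compact_subsets_iff)
  \<comment> \<open>It suffices to be close to \<open>G k\<close> at late stages, since passing from
    a point to its parent carries the closeness back down to stage \<open>N\<close>.\<close>
  have inA: "p \<in> A" if "p \<in> X" "N \<le> n" and p: "\<And>k. n \<le> k \<Longrightarrow> \<exists>x\<in>G k. \<rho> x p \<le> r k" for p n
  proof -
    have "\<exists>x\<in>G k. \<rho> x p \<le> r k" if "N \<le> k" "k \<le> n" for k
      using that(2,1)
    proof (induction rule: inc_induct)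
      case base
      then show ?case using p by blast
    next
      case (step k)
      then obtain y where y: "y \<in> G (Suc k)" "\<rho> y p \<le> r (Suc k)" by auto
      then obtain x where x: "x \<in> G k" "\<rho> x y + r (Suc k) < r k" using parent step by blast
      then have "\<rho> x p \<le> r k"
        using triangle[of x y p] y GX[of k] GX[of "Suc k"] \<open>p \<in> X\<close> by (auto simp: subset_iff)
      then show ?case using x by blast
    qed
    then have "\<exists>x\<in>G k. \<rho> x p \<le> r k" if "N \<le> k" for k
      using p[of k] that by (cases "k \<le> n") auto
    then show ?thesis using \<open>p \<in> X\<close> by (simp add: A_def)
  qed
  show "near (r n) (G n) A" if n: "N \<le> n" for n
    unfolding near_def
  proof (intro conjI ballI)
    fix p assume "p \<in> A"
    then obtain y where y: "y \<in> G (Suc n)" "\<rho> y p \<le> r (Suc n)" and pX: "p \<in> X"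
      using n unfolding A_def by (auto dest: spec[of _ "Suc n"])
    then obtain x where x: "x \<in> G n" "\<rho> x y + r (Suc n) < r n" using parent n by blast
    then have "\<rho> x p < r n"
      using triangle[of x y p] y GX[of n] GX[of "Suc n"] pX by (auto simp: subset_iff)
    then show "\<exists>x\<in>G n. \<rho> x p < r n" using x by blast
  next
    fix x assume x: "x \<in> G n"
    \<comment> \<open>Following children from \<open>x\<close> gives a decreasing sequence of closed
      balls; by compactness they share a point, which is the required point of
      \<open>A\<close>.\<close>
    have "\<exists>f. f 0 = x \<and> (\<forall>k. f k \<in> G (n + k) \<and> \<rho> (f k) (f (Suc k)) + r (Suc (n + k)) < r (n + k))"
    proof -
      have "\<exists>f. (\<forall>k. (f k \<in> G (n + k) \<and> (k = 0 \<longrightarrow> f k = x)) \<and> \<rho> (f k) (f (Suc k)) + r (Suc (n + k)) < r (n + k))"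
      proof (rule dependent_nat_choice)
        fix y k assume "y \<in> G (n + k) \<and> (k = 0 \<longrightarrow> y = x)"
        then show "\<exists>z. (z \<in> G (n + Suc k) \<and> (Suc k = 0 \<longrightarrow> z = x)) \<and> \<rho> y z + r (Suc (n + k)) < r (n + k)"
          using child[of "n + k" y] n by auto
      qed (use x in auto)
      then show ?thesis by blast
    qed
    then obtain f where f0: "f 0 = x" and f: "\<And>k. f k \<in> G (n + k)"
      and step: "\<And>k. \<rho> (f k) (f (Suc k)) + r (Suc (n + k)) < r (n + k)" by blast
    define B where "B = (\<lambda>k. mcball (f k) (r (n + k)))"
    have fX: "f k \<in> X" for k using f GX by blast
    have sub: "B (Suc k) \<subseteq> B k" for k
      using step[of k] triangle[of "f k" "f (Suc k)"] fX[of k] fX[of "Suc k"]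
      by (force simp: B_def)
    have "(\<Inter>k. B k) \<noteq> {}"
    proof (rule compact_space_imp_nest[OF compact])
      show "decseq B" using sub by (rule decseq_SucI)
      have "f k \<in> B k" for k using fX[of k] r0[of "n + k"] by (simp add: B_def)
      then show "B k \<noteq> {}" for k by blast
    qed (simp add: B_def)
    then obtain p where p: "\<And>k. p \<in> B k" by blast
    have pX: "p \<in> X" using p[of 0] by (simp add: B_def)
    have "p \<in> A"
    proof (rule inA[OF pX n])
      fix k assume "n \<le> k"
      then show "\<exists>x\<in>G k. \<rho> x p \<le> r k"
        using p[of "k - n"] f[of "k - n"] by (auto simp: B_def)
    qed
    \<comment> \<open>Strictness comes from the first child: \<open>p\<close> lies in the closed
      ball about \<open>f 1\<close>, which is strictly inside the ball about
      \<open>x\<close>.\<close>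
    moreover have "\<rho> x p < r n"
      using p[of 1] step[of 0] triangle[of x "f 1" p] f0 fX[of 0] fX[of 1] pX by (auto simp: B_def)
    ultimately show "\<exists>a\<in>A. \<rho> x a < r n" by blast
  qed
qed

end

section \<open>States and refinement\<close>

text \<open>A point \<open>x\<close> of a state stands for a piece of \<open>K (klab x)\<close> which at the same time is a piece of
  \<open>L (llab x)\<close> but not of earlier members of the increasing sequence \<open>L\<close>. A state constrains only the
  members with index below its level.\<close>

datatype 'a state =
  State (pts: "'a set") (klab: "'a \<Rightarrow> nat") (llab: "'a \<Rightarrow> nat") (level: nat) (radius: real)

context bounded_compact_metric
begin

text \<open>The separation \<open>2 * radius s\<close> makes the open balls about the points
  disjoint, so that a point of \<open>X\<close> has at most one center. The bound 1 on the radius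
  starts the geometric decay along chains.\<close>

definition valid :: "'a state \<Rightarrow> bool" where
  "valid s \<longleftrightarrow> finite (pts s) \<and> pts s \<subseteq> X \<and> 0 < radius s \<and> radius s \<le> 1 \<and>
     (\<forall>x\<in>pts s. klab s x < level s \<and> llab s x < level s) \<and>
     (\<forall>x\<in>pts s. \<forall>y\<in>pts s. x \<noteq> y \<longrightarrow> 2 * radius s \<le> \<rho> x y)"

definition kset :: "'a state \<Rightarrow> (nat \<Rightarrow> 'a set) set" where
  "kset s = {K \<in> topspace (seq_space X \<rho>).
     \<forall>j<level s. near (radius s) {x \<in> pts s. klab s x = j} (K j)}"

definition lset :: "'a state \<Rightarrow> (nat \<Rightarrow> 'a set) set" where
  "lset s = {L \<in> increasing_seqs X \<rho>.
     \<forall>i<level s. near (radius s) {x \<in> pts s. llab s x \<le> i} (L i)}"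

text \<open>The closed ball of the finer state about \<open>y\<close> lies in the open ball of the
  coarser state about \<open>x\<close>, by the triangle inequality.\<close>

definition encloses :: "'a state \<Rightarrow> 'a state \<Rightarrow> 'a \<Rightarrow> 'a \<Rightarrow> bool" where
  "encloses s t x y \<longleftrightarrow> \<rho> x y + radius t < radius s"

definition same_labels :: "'a state \<Rightarrow> 'a state \<Rightarrow> 'a \<Rightarrow> 'a \<Rightarrow> bool" where
  "same_labels s t x y \<longleftrightarrow> klab t y = klab s x \<and> llab t y = llab s x"

text \<open>The last alternative is forced by \<open>L\<close>: near an old point, \<open>L i\<close> may acquire new points that are
  not in the preceding members. They cannot be added to an old \<open>K j\<close>, so they are put into a fresh one.
  Along a branch the second label grows at each such change and stays bounded on \<open>L i\<close>, so only
  finitely many changes occur.\<close>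
definition refines :: "'a state \<Rightarrow> 'a state \<Rightarrow> bool" where
  "refines s t \<longleftrightarrow> valid t \<and> level s < level t \<and> radius t \<le> radius s / 2 \<and>
     (\<forall>y\<in>pts t. level s \<le> klab t y \<and> level s \<le> llab t y \<or>
        (\<exists>x\<in>pts s. encloses s t x y \<and>
           (same_labels s t x y \<or> level s \<le> klab t y \<and> llab s x < llab t y))) \<and>
     (\<forall>x\<in>pts s. \<exists>y\<in>pts t. encloses s t x y \<and> same_labels s t x y)"

section \<open>Refinement and the basic open sets of a state\<close>

lemma validD:
  assumes "valid s"
  shows "finite (pts s)" "pts s \<subseteq> X" "0 < radius s" "radius s \<le> 1"
    "\<And>x. x \<in> pts s \<Longrightarrow> klab s x < level s" "\<And>x. x \<in> pts s \<Longrightarrow> llab s x < level s"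
  using assms by (auto simp: valid_def)

lemma valid_center_unique:
  assumes "valid s" "x \<in> pts s" "y \<in> pts s" "p \<in> X" "\<rho> x p < radius s" "\<rho> y p < radius s"
  shows "x = y"
proof (rule ccontr)
  assume "x \<noteq> y"
  then have "2 * radius s \<le> \<rho> x y" using assms by (auto simp: valid_def)
  moreover have "\<rho> x y \<le> \<rho> x p + \<rho> y p"
    using triangle'[of x p y] assms validD(2)[OF assms(1)] by (auto simp: commute)
  ultimately show False using assms by linarith
qed

lemma refinesD:
  assumes "refines s t"
  shows "valid t" "level s < level t" "radius t \<le> radius s / 2"
    "\<And>y. y \<in> pts t \<Longrightarrow> llab t y < level s \<Longrightarrow> \<exists>x\<in>pts s. encloses s t x y \<and>
           (same_labels s t x y \<or> level s \<le> klab t y \<and> llab s x < llab t y)"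
    "\<And>y. y \<in> pts t \<Longrightarrow> klab t y < level s \<Longrightarrow> \<exists>x\<in>pts s. encloses s t x y \<and> same_labels s t x y"
    "\<And>x. x \<in> pts s \<Longrightarrow> \<exists>y\<in>pts t. encloses s t x y \<and> same_labels s t x y"
  using assms unfolding refines_def by (auto simp: not_le[symmetric])

lemma encloses_trans:
  assumes "encloses s t x y" "encloses t u y z" "x \<in> X" "y \<in> X" "z \<in> X"
  shows "encloses s u x z"
  using triangle[of x y z] assms by (auto simp: encloses_def)

text \<open>Levels increase, so a label that is fresh with respect to \<open>t\<close> is fresh with
  respect to \<open>s\<close>, and increases of \<open>llab\<close> along the two steps add up.
  Hence the three alternatives for a point are closed under composition.\<close>

lemma refines_trans:
  assumes s: "valid s" and st: "refines s t" and tu: "refines t u"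
  shows "refines s u"
proof -
  note vt = refinesD(1)[OF st] and vu = refinesD(1)[OF tu]
  note lst = refinesD(2)[OF st]
  have w: "encloses s u x z" if "encloses s t x y" "encloses t u y z" "x \<in> pts s" "y \<in> pts t" "z \<in> pts u" for x y z
    using encloses_trans that validD(2)[OF s] validD(2)[OF vt] validD(2)[OF vu] by blast
  have "level s \<le> klab u z \<and> level s \<le> llab u z \<or>
        (\<exists>x\<in>pts s. encloses s u x z \<and>
           (same_labels s u x z \<or> level s \<le> klab u z \<and> llab s x < llab u z))" (is "?new \<or> ?old")
    if z: "z \<in> pts u" for z
  proof (cases "level t \<le> klab u z \<and> level t \<le> llab u z")
    case True
    then show ?thesis using lst by auto
  next
    case False
    then obtain y where y: "y \<in> pts t" "encloses t u y z"
      "same_labels t u y z \<or> level t \<le> klab u z \<and> llab t y < llab u z"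
      using tu z unfolding refines_def by blast
    show ?thesis
    proof (cases "level s \<le> klab t y \<and> level s \<le> llab t y")
      case True
      then have ?new using y(3) lst by (auto simp: same_labels_def)
      then show ?thesis ..
    next
      case False
      then obtain x where x: "x \<in> pts s" "encloses s t x y"
        "same_labels s t x y \<or> level s \<le> klab t y \<and> llab s x < llab t y"
        using st y(1) unfolding refines_def by blast
      have "same_labels s u x z \<or> level s \<le> klab u z \<and> llab s x < llab u z"
        using x(3) y(3) lst by (auto simp: same_labels_def)
      then have ?old using w[OF x(2) y(2) x(1) y(1) z] x(1) by blast
      then show ?thesis ..
    qed
  qed
  moreover have "\<exists>z\<in>pts u. encloses s u x z \<and> same_labels s u x z" if x: "x \<in> pts s" for x
  proof -
    obtain y where y: "y \<in> pts t" "encloses s t x y" "same_labels s t x y"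
      using refinesD(6)[OF st x] by blast
    obtain z where z: "z \<in> pts u" "encloses t u y z" "same_labels t u y z"
      using refinesD(6)[OF tu y(1)] by blast
    have "same_labels s u x z" using y(3) z(3) by (simp add: same_labels_def)
    then show ?thesis using w[OF y(2) z(2) x y(1) z(1)] z(1) by blast
  qed
  moreover have "radius u \<le> radius s / 2"
    using refinesD(3)[OF st] refinesD(3)[OF tu] validD(3)[OF s] by linarith
  ultimately show ?thesis
    using vu lst refinesD(2)[OF tu] unfolding refines_def by auto
qed

lemma near_coarser:
  assumes near: "near (radius t) H A" and "H \<subseteq> X" "G \<subseteq> X" "A \<subseteq> X"
    and parent: "\<And>y. y \<in> H \<Longrightarrow> \<exists>x\<in>G. encloses s t x y"
    and child: "\<And>x. x \<in> G \<Longrightarrow> \<exists>y\<in>H. encloses s t x y"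
  shows "near (radius s) G A"
proof -
  have 1: "\<rho> x a < radius s" if "encloses s t x y" "\<rho> y a < radius t" "x \<in> G" "y \<in> H" "a \<in> A" for x y a
    using triangle[of x y a] that assms(2-4) by (auto simp: encloses_def subset_iff)
  show ?thesis
    unfolding near_def
  proof (intro conjI ballI)
    fix x assume x: "x \<in> G"
    then obtain y where y: "y \<in> H" "encloses s t x y" using child by blast
    then obtain a where "a \<in> A" "\<rho> y a < radius t" using near by (auto simp: near_def)
    then show "\<exists>a\<in>A. \<rho> x a < radius s" using 1 x y by blast
  next
    fix a assume a: "a \<in> A"
    then obtain y where y: "y \<in> H" "\<rho> y a < radius t" using near by (auto simp: near_def)
    then obtain x where "x \<in> G" "encloses s t x y" using parent by blast
    then show "\<exists>x\<in>G. \<rho> x a < radius s" using 1 a y by blast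
  qed
qed

text \<open>A \<open>klab\<close> below \<open>level s\<close> is not fresh, which leaves only
  points copying both labels of an enclosing old point.\<close>

lemma kset_parent:
  assumes "refines s t" "j < level s" "y \<in> {y \<in> pts t. klab t y = j}"
  shows "\<exists>x\<in>{x \<in> pts s. klab s x = j}. encloses s t x y"
  using refinesD(5)[OF assms(1), of y] assms(2,3) by (auto simp: same_labels_def)

lemma kset_child:
  assumes "refines s t" "x \<in> {x \<in> pts s. klab s x = j}"
  shows "\<exists>y\<in>{y \<in> pts t. klab t y = j}. encloses s t x y"
  using refinesD(6)[OF assms(1), of x] assms(2) by (auto simp: same_labels_def)

text \<open>In both alternatives with an old center \<open>x\<close>, \<open>llab\<close> does not
  drop from \<open>x\<close> to \<open>y\<close>, so \<open>x\<close> still belongs to the part of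
  \<open>s\<close> that approximates \<open>L i\<close>.\<close>

lemma lset_parent:
  assumes "refines s t" "i < level s" "y \<in> {y \<in> pts t. llab t y \<le> i}"
  shows "\<exists>x\<in>{x \<in> pts s. llab s x \<le> i}. encloses s t x y"
proof -
  obtain x where "x \<in> pts s" "encloses s t x y"
    "same_labels s t x y \<or> level s \<le> klab t y \<and> llab s x < llab t y"
    using refinesD(4)[OF assms(1), of y] assms(2,3) by auto
  then show ?thesis using assms(3) by (intro bexI[of _ x]) (auto simp: same_labels_def)
qed

lemma lset_child:
  assumes "refines s t" "x \<in> {x \<in> pts s. llab s x \<le> i}"
  shows "\<exists>y\<in>{y \<in> pts t. llab t y \<le> i}. encloses s t x y"
  using refinesD(6)[OF assms(1), of x] assms(2) by (auto simp: same_labels_def)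

lemma kset_subset: "kset s \<subseteq> topspace (seq_space X \<rho>)"
  by (auto simp: kset_def)

lemma increasing_seqs_subset: "increasing_seqs X \<rho> \<subseteq> topspace (seq_space X \<rho>)"
  by (auto simp: increasing_seqs_def)

lemma lset_subset: "lset s \<subseteq> increasing_seqs X \<rho>"
  by (auto simp: lset_def)

lemma kset_antimono:
  assumes "valid s" "refines s t"
  shows "kset t \<subseteq> kset s"
proof
  fix K assume K: "K \<in> kset t"
  then have KX: "K j \<subseteq> X" for j using compact_subsets_subset by (auto simp: kset_def)
  have "near (radius s) {x \<in> pts s. klab s x = j} (K j)" if "j < level s" for j
  proof (rule near_coarser)
    show "near (radius t) {y \<in> pts t. klab t y = j} (K j)"
      using K that refinesD(2)[OF assms(2)] by (auto simp: kset_def)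
  qed (use kset_parent kset_child assms that KX validD(2) refinesD(1) in blast)+
  then show "K \<in> kset s" using K by (auto simp: kset_def)
qed

lemma lset_antimono:
  assumes "valid s" "refines s t"
  shows "lset t \<subseteq> lset s"
proof
  fix L assume L: "L \<in> lset t"
  then have LX: "L i \<subseteq> X" for i
    using compact_subsets_subset lset_subset increasing_seqs_subset by fastforce
  have "near (radius s) {x \<in> pts s. llab s x \<le> i} (L i)" if "i < level s" for i
  proof (rule near_coarser)
    show "near (radius t) {y \<in> pts t. llab t y \<le> i} (L i)"
      using L that refinesD(2)[OF assms(2)] by (auto simp: lset_def)
  qed (use lset_parent lset_child assms that LX validD(2) refinesD(1) in blast)+
  then show "L \<in> lset s" using L by (auto simp: lset_def)
qed

lemma openin_kset: "valid s \<Longrightarrow> openin (seq_space X \<rho>) (kset s)"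
  unfolding kset_def by (rule openin_seq_space_near) (auto dest: validD)

lemma openin_lset:
  assumes "valid s"
  shows "openin (increasing_seq_space X \<rho>) (lset s)"
proof -
  let ?W = "{K \<in> topspace (seq_space X \<rho>). \<forall>i<level s. near (radius s) {x \<in> pts s. llab s x \<le> i} (K i)}"
  have "openin (seq_space X \<rho>) ?W"
    by (rule openin_seq_space_near) (use assms in \<open>auto dest: validD\<close>)
  moreover have "lset s = ?W \<inter> increasing_seqs X \<rho>"
    using increasing_seqs_subset by (auto simp: lset_def)
  ultimately show ?thesis
    by (auto simp: increasing_seq_space_def openin_subtopology)
qed

lemma kset_nonempty:
  assumes "valid s"
  shows "kset s \<noteq> {}"
proof -
  \<comment> \<open>The finite sets of the state serve as a member; at indices from the level on
    they are empty.\<close>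
  have "(\<lambda>j. {x \<in> pts s. klab s x = j}) \<in> kset s"
    unfolding kset_def using validD[OF assms]
    by (auto intro!: near_refl finite_in_compact_subsets)
  then show ?thesis by blast
qed

lemma lset_nonempty:
  assumes "valid s"
  shows "lset s \<noteq> {}"
proof -
  have "(\<lambda>i. {x \<in> pts s. llab s x \<le> i}) \<in> lset s"
    unfolding lset_def increasing_seqs_def using validD[OF assms]
    by (auto intro!: near_refl finite_in_compact_subsets)
  then show ?thesis by blast
qed

end

section \<open>Infinite chains of refinements, their limits and the common union\<close>

locale refinement_chain = bounded_compact_metric +
  fixes s :: "nat \<Rightarrow> 'a state"
  assumes valid: "valid (s n)" and refines: "refines (s n) (s (Suc n))"
begin

lemma level_mono: "m \<le> n \<Longrightarrow> level (s m) \<le> level (s n)"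
  by (rule lift_Suc_mono_le[of "\<lambda>n. level (s n)"]) (simp_all add: refinesD(2)[OF refines] less_imp_le)

lemma level_ge: "n \<le> level (s n)"
proof (induction n)
  case (Suc n)
  then show ?case using refinesD(2)[OF refines, of n] by linarith
qed simp

lemma radius_le: "radius (s n) \<le> (1/2) ^ n"
proof (induction n)
  case (Suc n)
  then show ?case using refinesD(3)[OF refines, of n] by simp
qed (use validD(4)[OF valid] in simp)

lemma radius_small:
  assumes "e > 0"
  obtains n where "N \<le> n" "2 * radius (s n) < e"
proof -
  obtain k where k: "(1/2) ^ k < e / 2"
    using real_arch_pow_inv[of "e/2" "1/2"] assms by auto
  have "radius (s (max N k)) \<le> (1/2) ^ max N k" by (rule radius_le)
  also have "\<dots> \<le> (1/2) ^ k" by (rule power_decreasing) auto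
  finally show thesis using that[of "max N k"] k by simp
qed

text \<open>At stage \<open>n\<close> the point and the set share a center, so they are less than
  twice the radius apart; the radii tend to 0 and \<open>A\<close> is closed.\<close>

lemma in_limit_set:
  assumes "A \<in> compact_subsets X \<rho>" "p \<in> X"
    and "\<And>n. N \<le> n \<Longrightarrow> \<exists>x\<in>pts (s n). \<rho> x p < radius (s n) \<and> (\<exists>a\<in>A. \<rho> x a < radius (s n))"
  shows "p \<in> A"
proof (rule in_compact_subset_if_near[OF assms(1,2)])
  fix e :: real assume "e > 0"
  then obtain n where n: "N \<le> n" "2 * radius (s n) < e" by (rule radius_small)
  then obtain x a where xa: "x \<in> pts (s n)" "\<rho> x p < radius (s n)" "a \<in> A" "\<rho> x a < radius (s n)"
    using assms(3) by blast
  have "\<rho> p a \<le> \<rho> x p + \<rho> x a"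
    using triangle'[of p x a] xa assms(2) validD(2)[OF valid] compact_subsets_subset[OF assms(1)]
    by (auto simp: commute)
  then show "\<exists>a\<in>A. \<rho> p a < e" using xa n by (intro bexI[of _ a]) auto
qed

text \<open>Points carrying an already constrained \<open>klab\<close> copy both labels from then
  on, which bounds \<open>llab\<close> on \<open>K j\<close>. Conversely, the centers of a point of
  \<open>L i\<close> have nondecreasing \<open>llab\<close> bounded by \<open>i\<close>, so their
  labels stabilise and the final \<open>klab\<close> names a \<open>K j\<close> containing the
  point.\<close>

lemma Union_eq:
  assumes K: "\<And>n. K \<in> kset (s n)" and L: "\<And>n. L \<in> lset (s n)"
  shows "(\<Union>j. K j) = (\<Union>i. L i)"
proof
  have Kc: "K j \<in> compact_subsets X \<rho>" for j using K[of 0] by (auto simp: kset_def)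
  have Lc: "L i \<in> compact_subsets X \<rho>" for i using L[of 0] by (auto simp: lset_def increasing_seqs_def)
  have Kn: "near (radius (s n)) {x \<in> pts (s n). klab (s n) x = j} (K j)" if "j < level (s n)" for n j
    using K that by (auto simp: kset_def)
  have Ln: "near (radius (s n)) {x \<in> pts (s n). llab (s n) x \<le> i} (L i)" if "i < level (s n)" for n i
    using L that by (auto simp: lset_def)
  show "(\<Union>j. K j) \<subseteq> (\<Union>i. L i)"
  proof
    fix p assume "p \<in> (\<Union>j. K j)"
    then obtain j where p: "p \<in> K j" by blast
    \<comment> \<open>At stage \<open>Suc j\<close> the index \<open>j\<close> is already below the
      level, and \<open>I\<close> exceeds every \<open>llab\<close> present; later points with
      \<open>klab\<close> equal to \<open>j\<close> inherit these values.\<close>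
    define I where "I = level (s (Suc j))"
    have I: "Suc j \<le> I" unfolding I_def by (rule level_ge)
    have bound: "\<forall>x\<in>pts (s n). klab (s n) x = j \<longrightarrow> llab (s n) x < I" if "Suc j \<le> n" for n
      using that
    proof (induction rule: dec_induct)
      case base
      then show ?case using validD(6)[OF valid] by (auto simp: I_def)
    next
      case (step n)
      have "j < level (s n)" using step(1) level_ge[of n] by linarith
      then show ?case
        using refinesD(5)[OF refines, of _ n] step(3) by (fastforce simp: same_labels_def)
    qed
    have "p \<in> L I"
    \<comment> \<open>From stage \<open>Suc I\<close> on, both \<open>I\<close> and \<open>j\<close>
      are below the level, so \<open>L I\<close> and \<open>K j\<close> are both
      constrained.\<close>
    proof (rule in_limit_set[OF Lc, where N = "Suc I"])
      show "p \<in> X" using p Kc compact_subsets_subset by blast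
    next
      fix n assume n: "Suc I \<le> n"
      then have "j < level (s n)" "I < level (s n)" using level_ge[of n] I by linarith+
      obtain x where x: "x \<in> pts (s n)" "klab (s n) x = j" "\<rho> x p < radius (s n)"
        using Kn[OF \<open>j < level (s n)\<close>] p by (auto simp: near_def)
      then have "llab (s n) x \<le> I" using bound[of n] n I by (auto simp: less_imp_le)
      then obtain a where "a \<in> L I" "\<rho> x a < radius (s n)"
        using Ln[OF \<open>I < level (s n)\<close>] x(1) by (auto simp: near_def)
      then show "\<exists>x\<in>pts (s n). \<rho> x p < radius (s n) \<and> (\<exists>a\<in>L I. \<rho> x a < radius (s n))"
        using x by blast
    qed
    then show "p \<in> (\<Union>i. L i)" by blast
  qed
  show "(\<Union>i. L i) \<subseteq> (\<Union>j. K j)"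
  proof
    fix p assume "p \<in> (\<Union>i. L i)"
    then obtain i where p: "p \<in> L i" by blast
    have pX: "p \<in> X" using p Lc compact_subsets_subset by blast
    have "\<exists>x. i < n \<longrightarrow> x \<in> pts (s n) \<and> llab (s n) x \<le> i \<and> \<rho> x p < radius (s n)" for n
    proof (cases "i < n")
      case True
      then have "i < level (s n)" using level_ge[of n] by linarith
      then show ?thesis using Ln p by (fastforce simp: near_def)
    qed auto
    then obtain x where x: "\<And>n. i < n \<Longrightarrow> x n \<in> pts (s n)" "\<And>n. i < n \<Longrightarrow> llab (s n) (x n) \<le> i"
      "\<And>n. i < n \<Longrightarrow> \<rho> (x n) p < radius (s n)"
      by metis
    \<comment> \<open>The parent of \<open>x (Suc n)\<close> also has \<open>p\<close> in its ball;
      by separation it is \<open>x n\<close>, so the refinement rule compares the labels of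
      consecutive centers.\<close>
    have step: "same_labels (s n) (s (Suc n)) (x n) (x (Suc n)) \<or> llab (s n) (x n) < llab (s (Suc n)) (x (Suc n))"
      if n: "i < n" for n
    proof -
      have n': "i < Suc n" using n by simp
      have "llab (s (Suc n)) (x (Suc n)) < level (s n)"
        using x(2)[OF n'] level_ge[of n] n by linarith
      then obtain z where z: "z \<in> pts (s n)" "encloses (s n) (s (Suc n)) z (x (Suc n))"
        "same_labels (s n) (s (Suc n)) z (x (Suc n)) \<or> llab (s n) z < llab (s (Suc n)) (x (Suc n))"
        using refinesD(4)[OF refines x(1)[OF n']] by blast
      have "z \<in> X" "x (Suc n) \<in> X"
        using z(1) x(1)[OF n'] validD(2)[OF valid] by blast+
      then have "\<rho> z p < radius (s n)"
        using triangle[of z "x (Suc n)" p] z(2) x(3)[OF n'] pX by (auto simp: encloses_def)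
      then have "z = x n"
        using valid_center_unique[OF valid z(1) x(1)[OF n] pX] x(3)[OF n] by blast
      then show ?thesis using z(3) by simp
    qed
    \<comment> \<open>The values \<open>llab (s n) (x n)\<close> are bounded by \<open>i\<close>, so
      their maximum is attained.\<close>
    obtain n0 where n0: "i < n0" and max: "\<And>n. i < n \<Longrightarrow> llab (s n) (x n) \<le> llab (s n0) (x n0)"
    proof -
      have "\<exists>n0>i. \<forall>n>i. llab (s n) (x n) \<le> llab (s n0) (x n0)"
        by (rule ex_has_greatest_nat[of _ "Suc i" _ "Suc i"]) (use x(2) in \<open>auto simp: less_Suc_eq_le\<close>)
      then show ?thesis using that by blast
    qed
    \<comment> \<open>After the maximum \<open>llab\<close> cannot grow any more, so every step
      copies both labels.\<close>
    have const: "klab (s n) (x n) = klab (s n0) (x n0) \<and> llab (s n) (x n) = llab (s n0) (x n0)" if "n0 \<le> n" for n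
      using that
    proof (induction rule: dec_induct)
      case (step n)
      have "i < n" using step(1) n0 by linarith
      then show ?case
        using \<open>\<And>n. i < n \<Longrightarrow> _ \<or> _\<close>[of n] max[of "Suc n"] step(3) by (auto simp: same_labels_def)
    qed simp
    define j where "j = klab (s n0) (x n0)"
    have "p \<in> K j"
    proof (rule in_limit_set[OF Kc pX, where N = n0])
      fix n assume n: "n0 \<le> n"
      then have "i < n" using n0 by linarith
      have "j < level (s n0)" unfolding j_def using validD(5)[OF valid x(1)[OF n0]] .
      then have "j < level (s n)" using level_mono[OF n] by linarith
      then obtain a where "a \<in> K j" "\<rho> (x n) a < radius (s n)"
        using Kn[of j n] x(1)[OF \<open>i < n\<close>] const[OF n] by (auto simp: near_def j_def)
      then show "\<exists>x\<in>pts (s n). \<rho> x p < radius (s n) \<and> (\<exists>a\<in>K j. \<rho> x a < radius (s n))"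
        using x \<open>i < n\<close> by blast
    qed
    then show "p \<in> (\<Union>j. K j)" by blast
  qed
qed

lemma first_level:
  obtains N where "\<And>n. j < level (s n) \<longleftrightarrow> N \<le> n"
proof -
  define N where "N = (LEAST n. j < level (s n))"
  have "j < level (s (Suc j))" using level_ge[of "Suc j"] by linarith
  then have "j < level (s N)" unfolding N_def by (rule LeastI)
  then have "j < level (s n) \<longleftrightarrow> N \<le> n" for n
    using level_mono[of N n] Least_le[of "\<lambda>n. j < level (s n)" n] by (auto simp: N_def)
  then show thesis by (rule that)
qed

lemma kset_limit: "\<exists>K. \<forall>n. K \<in> kset (s n)"
proof -
  have "\<exists>A\<in>compact_subsets X \<rho>. \<forall>n. j < level (s n) \<longrightarrow>
     near (radius (s n)) {x \<in> pts (s n). klab (s n) x = j} A" for j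
  proof -
    obtain N where N: "\<And>n. j < level (s n) \<longleftrightarrow> N \<le> n" using first_level[of j] by blast
    let ?G = "\<lambda>n. {x \<in> pts (s n). klab (s n) x = j}"
    have G: "finite (?G n)" "?G n \<subseteq> X" for n
      using validD(1,2)[OF valid] by auto
    have parent: "\<exists>x\<in>?G n. \<rho> x y + radius (s (Suc n)) < radius (s n)" if "N \<le> n" "y \<in> ?G (Suc n)" for n y
      using kset_parent[OF refines _ that(2)] N that(1) by (simp add: encloses_def)
    have child: "\<exists>y\<in>?G (Suc n). \<rho> x y + radius (s (Suc n)) < radius (s n)" if "x \<in> ?G n" for n x
      using kset_child[OF refines that] by (simp add: encloses_def)
    note lim = near_limit[of ?G "\<lambda>n. radius (s n)" N, OF G validD(3)[OF valid] parent child]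
    show ?thesis
      using lim(2) unfolding N by (intro bexI[OF _ lim(1)]) blast
  qed
  then obtain K where "\<And>j. K j \<in> compact_subsets X \<rho>"
    "\<And>j n. j < level (s n) \<Longrightarrow> near (radius (s n)) {x \<in> pts (s n). klab (s n) x = j} (K j)"
    by metis
  then show ?thesis by (auto simp: kset_def)
qed

lemma lset_limit: "\<exists>L. \<forall>n. L \<in> lset (s n)"
proof -
  \<comment> \<open>The limit sets are written out explicitly instead of being chosen index by
    index, so that \<open>L i \<subseteq> L (Suc i)\<close> can be checked.\<close>
  define L where "L = (\<lambda>i. {p \<in> X. \<forall>n. i < level (s n) \<longrightarrow>
     (\<exists>x\<in>{x \<in> pts (s n). llab (s n) x \<le> i}. \<rho> x p \<le> radius (s n))})"
  have "L i \<in> compact_subsets X \<rho> \<and> (\<forall>n. i < level (s n) \<longrightarrow>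
     near (radius (s n)) {x \<in> pts (s n). llab (s n) x \<le> i} (L i))" for i
  proof -
    obtain N where N: "\<And>n. i < level (s n) \<longleftrightarrow> N \<le> n" using first_level[of i] by blast
    let ?G = "\<lambda>n. {x \<in> pts (s n). llab (s n) x \<le> i}"
    have G: "finite (?G n)" "?G n \<subseteq> X" for n
      using validD(1,2)[OF valid] by auto
    have parent: "\<exists>x\<in>?G n. \<rho> x y + radius (s (Suc n)) < radius (s n)" if "N \<le> n" "y \<in> ?G (Suc n)" for n y
      using lset_parent[OF refines _ that(2)] N that(1) by (simp add: encloses_def)
    have child: "\<exists>y\<in>?G (Suc n). \<rho> x y + radius (s (Suc n)) < radius (s n)" if "x \<in> ?G n" for n x
      using lset_child[OF refines that] by (simp add: encloses_def)
    note lim = near_limit[of ?G "\<lambda>n. radius (s n)" N, OF G validD(3)[OF valid] parent child]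
    show ?thesis
      unfolding L_def N using lim by blast
  qed
  moreover have "L i \<subseteq> L (Suc i)" for i
  proof
    fix p assume p: "p \<in> L i"
    have "\<exists>x\<in>{x \<in> pts (s n). llab (s n) x \<le> Suc i}. \<rho> x p \<le> radius (s n)" if "Suc i < level (s n)" for n
    proof -
      have "i < level (s n)" using that by simp
      then obtain x where "x \<in> pts (s n)" "llab (s n) x \<le> i" "\<rho> x p \<le> radius (s n)"
        using p by (auto simp: L_def)
      then show ?thesis by (intro bexI[of _ x]) auto
    qed
    then show "p \<in> L (Suc i)" using p by (auto simp: L_def)
  qed
  ultimately have "\<forall>n. L \<in> lset (s n)" by (auto simp: lset_def increasing_seqs_def)
  then show ?thesis by blast
qed

end

section \<open>Extending states into open sets\<close>

context bounded_compact_metric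
begin

text \<open>Finitely many strict inequalities leave room for one radius that keeps the new balls
  inside the old ones, separates the points of \<open>P\<close>, and meets the size bounds.\<close>

lemma fine_radius:
  assumes "valid s" "finite P" "P \<subseteq> X" "e > 0"
  obtains d where "0 < d" "d \<le> e" "d \<le> radius s / 2"
    "\<And>x y. x \<in> pts s \<Longrightarrow> y \<in> P \<Longrightarrow> \<rho> x y < radius s \<Longrightarrow> \<rho> x y + d < radius s"
    "\<And>y z. y \<in> P \<Longrightarrow> z \<in> P \<Longrightarrow> y \<noteq> z \<Longrightarrow> 2 * d \<le> \<rho> y z"
proof -
  \<comment> \<open>Half of the margin is taken so that the enclosing inequality stays
    strict.\<close>
  let ?D1 = "(\<lambda>(x, y). (radius s - \<rho> x y) / 2) ` {(x, y) \<in> pts s \<times> P. \<rho> x y < radius s}"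
  let ?D2 = "(\<lambda>(y, z). \<rho> y z / 2) ` {(y, z) \<in> P \<times> P. y \<noteq> z}"
  have "finite {(x, y) \<in> pts s \<times> P. \<rho> x y < radius s}" "finite {(y, z) \<in> P \<times> P. y \<noteq> z}"
    using assms validD(1)[OF assms(1)]
    by (auto intro: finite_subset[of _ "pts s \<times> P"] finite_subset[of _ "P \<times> P"])
  then have fin: "finite ({e, radius s / 2} \<union> ?D1 \<union> ?D2)" by simp
  have "0 < \<rho> y z" if "y \<in> P" "z \<in> P" "y \<noteq> z" for y z
    using that assms(3) by (auto simp: subset_iff)
  then have "\<exists>d>0. \<forall>x\<in>{e, radius s / 2} \<union> ?D1 \<union> ?D2. d \<le> x"
    using assms validD(3)[OF assms(1)] by (intro finite_positive_lower_bound[OF fin]) auto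
  then obtain d where d: "d > 0" "\<And>x. x \<in> {e, radius s / 2} \<union> ?D1 \<union> ?D2 \<Longrightarrow> d \<le> x"
    by blast
  show thesis
  proof (rule that)
    show "0 < d" by (rule d)
    show "d \<le> e" "d \<le> radius s / 2" by (rule d(2); simp)+
    show "\<rho> x y + d < radius s" if "x \<in> pts s" "y \<in> P" "\<rho> x y < radius s" for x y
    proof -
      have "d \<le> (radius s - \<rho> x y) / 2" by (rule d(2)) (use that in force)
      then show ?thesis using that(3) by (simp add: field_simps)
    qed
    show "2 * d \<le> \<rho> y z" if "y \<in> P" "z \<in> P" "y \<noteq> z" for y z
    proof -
      have "d \<le> \<rho> y z / 2" by (rule d(2)) (use that in force)
      then show ?thesis by linarith
    qed
  qed
qed

text \<open>A member of \<open>W\<close> is replaced by an increasing sequence of finite sets. Its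
  points take as \<open>llab\<close> the index of first occurrence, and copy the \<open>klab\<close>
  of their old center exactly when this index agrees with that of the center.\<close>

lemma lset_extend:
  assumes s: "valid s" and W: "openin (increasing_seq_space X \<rho>) W" "W \<noteq> {}" "W \<subseteq> lset s"
  shows "\<exists>t. refines s t \<and> lset t \<subseteq> W"
proof -
  obtain W' where W': "openin (seq_space X \<rho>) W'" "W = W' \<inter> increasing_seqs X \<rho>"
    using W(1) by (auto simp: increasing_seq_space_def openin_subtopology)
  obtain L where L: "L \<in> W" using W(2) by blast
  then have Linc: "L \<in> increasing_seqs X \<rho>" and LW': "L \<in> W'" using W' by auto
  have Lc: "L i \<in> compact_subsets X \<rho>" for i
    using Linc increasing_seqs_subset by auto
  have Lmono: "L i \<subseteq> L j" if "i \<le> j" for i j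
    by (rule lift_Suc_mono_le[of L]) (use that Linc in \<open>auto simp: increasing_seqs_def\<close>)
  have LX: "L i \<subseteq> X" for i using Lc compact_subsets_subset by blast
  obtain m0 e where e: "e > 0"
    and eW: "\<And>K'. K' \<in> topspace (seq_space X \<rho>) \<Longrightarrow> (\<And>n. n < m0 \<Longrightarrow> near e (L n) (K' n)) \<Longrightarrow> K' \<in> W'"
    using openin_seq_space_imp_near[OF W'(1) LW'] by metis
  have "\<exists>C. finite C \<and> C \<subseteq> L i \<and> near (e/2) (L i) C" for i
    using finite_near_subset[OF Lc] e by simp
  then obtain C0 where C0: "\<And>i. finite (C0 i)" "\<And>i. C0 i \<subseteq> L i" "\<And>i. near (e/2) (L i) (C0 i)"
    by metis
  \<comment> \<open>Accumulating the finite sets makes them increasing; they stay inside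
    \<open>L i\<close> because \<open>L\<close> increases.\<close>
  define C where "C = (\<lambda>i. \<Union>j\<le>i. C0 j)"
  have Cfin: "finite (C i)" for i using C0(1) by (auto simp: C_def)
  have CL: "C i \<subseteq> L i" for i
    unfolding C_def by (rule UN_least) (rule order_trans[OF C0(2) Lmono], simp)
  have CX: "C i \<subseteq> X" for i using CL LX by blast
  have Cmono: "C i \<subseteq> C j" if "i \<le> j" for i j using that by (force simp: C_def)
  have Cnear: "near (e/2) (L i) (C i)" for i
  proof -
    have "\<exists>c\<in>C i. \<rho> a c < e/2" if "a \<in> L i" for a
    proof -
      obtain c where "c \<in> C0 i" "\<rho> a c < e/2" using C0(3)[of i] \<open>a \<in> L i\<close> by (auto simp: near_def)
      then show ?thesis by (intro bexI[of _ c]) (auto simp: C_def)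
    qed
    moreover have "\<exists>a\<in>L i. \<rho> a c < e/2" if "c \<in> C i" for c
    proof -
      have "c \<in> L i" "c \<in> X" using that CL LX by blast+
      then show ?thesis using e by (intro bexI[of _ c]) auto
    qed
    ultimately show ?thesis by (simp add: near_def)
  qed
  define m where "m = max m0 (Suc (level s))"
  define P where "P = C m"
  obtain d where d: "0 < d" "d \<le> e/2" "d \<le> radius s / 2"
    "\<And>x y. x \<in> pts s \<Longrightarrow> y \<in> P \<Longrightarrow> \<rho> x y < radius s \<Longrightarrow> \<rho> x y + d < radius s"
    "\<And>y z. y \<in> P \<Longrightarrow> z \<in> P \<Longrightarrow> y \<noteq> z \<Longrightarrow> 2 * d \<le> \<rho> y z"
    using fine_radius[OF s, of P "e/2"] Cfin CX e unfolding P_def by (metis half_gt_zero)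
  have Cinc: "C \<in> increasing_seqs X \<rho>"
    using Cfin CX Cmono by (auto simp: increasing_seqs_def intro!: finite_in_compact_subsets)
  have "C \<in> W'"
  proof (rule eW)
    show "C \<in> topspace (seq_space X \<rho>)" using Cinc increasing_seqs_subset by blast
    show "near e (L n) (C n)" for n using near_mono[OF Cnear] e by simp
  qed
  \<comment> \<open>Membership in \<open>lset s\<close> is what provides old centers for the new
    points and new points near every old center.\<close>
  then have Cs: "C \<in> lset s" using W' Cinc W(3) by blast
  define l where "l = (\<lambda>y. LEAST i. y \<in> C i)"
  have lC: "y \<in> C (l y)" if "y \<in> P" for y
    unfolding l_def by (rule LeastI[of _ m]) (use that in \<open>simp add: P_def\<close>)
  have lle: "l y \<le> i" if "y \<in> C i" for y i unfolding l_def using that by (rule Least_le)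
  have Ceq: "{y \<in> P. l y \<le> i} = C i" if "i \<le> m" for i
    using lC lle Cmono that by (auto simp: P_def subset_iff)
  define pa where "pa = (\<lambda>y. SOME x. x \<in> pts s \<and> \<rho> x y < radius s)"
  have paI: "pa y \<in> pts s \<and> \<rho> (pa y) y < radius s" if "x \<in> pts s" "\<rho> x y < radius s" for x y
    unfolding pa_def by (rule someI[of _ x]) (use that in blast)
  have pa: "pa y \<in> pts s \<and> \<rho> (pa y) y < radius s \<and> llab s (pa y) \<le> l y" if y: "y \<in> P" "l y < level s" for y
  proof -
    obtain x where x: "x \<in> pts s" "llab s x \<le> l y" "\<rho> x y < radius s"
      using Cs y(2) lC[OF y(1)] unfolding lset_def near_def by blast
    moreover have "pa y = x"
      using valid_center_unique[OF s _ x(1) _ _ x(3)] paI[OF x(1,3)] y(1) CX by (auto simp: P_def)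
    ultimately show ?thesis by simp
  qed
  \<comment> \<open>A point that enters later than its old center cannot join the old
    \<open>K j\<close>, and a point with \<open>l y\<close> at least \<open>level s\<close> is new
    for both sequences; both receive the fresh index \<open>level s\<close>.\<close>
  define k where "k = (\<lambda>y. if l y < level s \<and> llab s (pa y) = l y then klab s (pa y) else level s)"
  \<comment> \<open>The level is \<open>Suc m\<close> because points of \<open>P = C m\<close> may
    have first index \<open>m\<close>.\<close>
  define t where "t = State P k l (Suc m) d"
  have t [simp]: "pts t = P" "klab t = k" "llab t = l" "level t = Suc m" "radius t = d"
    by (simp_all add: t_def)
  have lm: "level s < m" by (simp add: m_def)
  have "k y \<le> level s" if "y \<in> P" for y
    using pa[OF that] validD(5)[OF s] by (auto simp: k_def less_imp_le)
  then have kt: "k y < Suc m" if "y \<in> P" for y using that lm by force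
  have lt: "l y < Suc m" if "y \<in> P" for y using that lle[of y m] by (simp add: P_def)
  have "valid t"
    unfolding valid_def using Cfin CX d kt lt validD(4)[OF s] by (auto simp: P_def)
  moreover have "level s \<le> k y \<and> level s \<le> l y \<or>
        (\<exists>x\<in>pts s. encloses s t x y \<and> (same_labels s t x y \<or> level s \<le> k y \<and> llab s x < l y))"
    if y: "y \<in> P" for y
  proof (cases "l y < level s")
    case False
    then show ?thesis by (simp add: k_def)
  next
    case True
    note p = pa[OF y True]
    have "encloses s t (pa y) y" using d(4)[of "pa y" y] p y by (simp add: encloses_def)
    moreover have "same_labels s t (pa y) y \<or> level s \<le> k y \<and> llab s (pa y) < l y"
      using p True by (auto simp: same_labels_def k_def)
    ultimately show ?thesis using p by blast
  qed
  moreover have "\<exists>y\<in>P. encloses s t x y \<and> same_labels s t x y" if x: "x \<in> pts s" for x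
  proof -
    have lx: "llab s x < level s" using validD(6)[OF s x] .
    then obtain y where y: "y \<in> C (llab s x)" "\<rho> x y < radius s"
      using Cs x by (fastforce simp: lset_def near_def)
    have yP: "y \<in> P" using y(1) Cmono[of "llab s x" m] lx lm by (auto simp: P_def)
    have ly: "l y \<le> llab s x" using lle y(1) by blast
    then have p: "pa y \<in> pts s" "\<rho> (pa y) y < radius s" "llab s (pa y) \<le> l y"
      using pa[OF yP] lx by auto
    \<comment> \<open>Since \<open>y\<close> has center \<open>x\<close>, its first index is
      squeezed between \<open>llab s x\<close> and itself, so it equals \<open>llab s x\<close> and
      both labels are copied.\<close>
    have "pa y = x"
      using valid_center_unique[OF s p(1) x _ p(2) y(2)] yP CX by (auto simp: P_def)
    then have "same_labels s t x y" using p ly lx by (simp add: same_labels_def k_def)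
    moreover have "encloses s t x y" using d(4)[OF x yP y(2)] by (simp add: encloses_def)
    ultimately show ?thesis using yP by blast
  qed
  ultimately have "refines s t"
    unfolding refines_def using lm d(3) by simp
  moreover have "lset t \<subseteq> W"
  proof
    fix L' assume L': "L' \<in> lset t"
    then have L'inc: "L' \<in> increasing_seqs X \<rho>" using lset_subset by blast
    then have L'top: "L' \<in> topspace (seq_space X \<rho>)" using increasing_seqs_subset by blast
    have "L' \<in> W'"
    proof (rule eW[OF L'top])
      fix n assume "n < m0"
      then have n: "n < Suc m" "n \<le> m" by (auto simp: m_def)
      have "near d {y \<in> P. l y \<le> n} (L' n)" using L' n(1) by (simp add: lset_def)
      then have "near d (C n) (L' n)" using Ceq[OF n(2)] by simp
      moreover have "L' n \<subseteq> X" using L'top compact_subsets_subset by auto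
      ultimately have "near (e/2 + d) (L n) (L' n)"
        using near_trans[OF Cnear _ LX CX] by blast
      then show "near e (L n) (L' n)" using d(2) by (elim near_mono) simp
    qed
    then show "L' \<in> W" using W' L'inc by blast
  qed
  ultimately show ?thesis by blast
qed

end

section \<open>Spaces without isolated points\<close>

locale perfect_compact_metric = bounded_compact_metric +
  assumes perfect: "dense_in_itself mtopology"
begin

text \<open>Removing the other points of a finite ball would leave the open singleton of its
  center.\<close>

lemma infinite_mball:
  assumes "x \<in> X" "e > 0"
  shows "infinite (mball x e)"
proof
  assume "finite (mball x e)"
  then have "finite (mball x e - {x})" by simp
  then have "closedin mtopology (mball x e - {x})"
    by (intro closedin_Hausdorff_finite[OF Hausdorff_space_mtopology]) auto
  then have "openin mtopology (mball x e - (mball x e - {x}))"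
    by (intro openin_diff openin_mball)
  moreover have "mball x e - (mball x e - {x}) = {x}" using assms by auto
  ultimately show False using perfect assms(1) by (simp add: dense_in_itself_def)
qed

text \<open>The sets are moved one after another: every ball about a point of \<open>C n\<close> is
  infinite, so the point can be shifted slightly to avoid the finitely many points already in
  use.\<close>

lemma disjoint_near:
  fixes n :: nat
  assumes C: "\<And>j. finite (C j)" "\<And>j. C j \<subseteq> X" and e: "e > 0"
  shows "\<exists>B. (\<forall>j<n. finite (B j) \<and> B j \<subseteq> X \<and> near e (C j) (B j)) \<and>
     (\<forall>i<n. \<forall>j<n. i \<noteq> j \<longrightarrow> B i \<inter> B j = {})"
proof (induction n)
  case (Suc n)
  then obtain B where B: "\<forall>j<n. finite (B j) \<and> B j \<subseteq> X \<and> near e (C j) (B j)"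
    and dis: "\<forall>i<n. \<forall>j<n. i \<noteq> j \<longrightarrow> B i \<inter> B j = {}"
    by (elim exE conjE)
  have "finite (\<Union>j<n. B j)" using B by blast
  then have "\<exists>y. y \<in> mball x e \<and> y \<notin> (\<Union>j<n. B j)" if "x \<in> C n" for x
    using infinite_mball[of x e] C(2)[of n] e that by (metis finite_subset subsetD subsetI)
  then obtain f where f: "\<And>x. x \<in> C n \<Longrightarrow> f x \<in> mball x e" "\<And>x. x \<in> C n \<Longrightarrow> f x \<notin> (\<Union>j<n. B j)"
    by metis
  have "near e (C n) (f ` C n)" using f(1) by (auto simp: near_def)
  moreover have "f ` C n \<subseteq> X" using f(1) by auto
  moreover have "B j \<inter> f ` C n = {}" if "j < n" for j using f(2) that by blast
  ultimately show ?case
    using B dis C(1) by (intro exI[of _ "B(n := f ` C n)"]) (auto simp: less_Suc_eq Int_commute)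
qed simp

text \<open>A member of \<open>W\<close> is replaced by pairwise disjoint finite sets. Disjointness
  gives each point a single \<open>klab\<close>; its \<open>llab\<close> is then copied from the old
  center or chosen fresh.\<close>

lemma kset_extend:
  assumes s: "valid s" and W: "openin (seq_space X \<rho>) W" "W \<noteq> {}" "W \<subseteq> kset s"
  shows "\<exists>t. refines s t \<and> kset t \<subseteq> W"
proof -
  obtain K where K: "K \<in> W" using W(2) by blast
  then have Kc: "K j \<in> compact_subsets X \<rho>" for j
    using W(3) kset_subset by fastforce
  have KX: "K j \<subseteq> X" for j using Kc compact_subsets_subset by blast
  obtain m0 e where e: "e > 0"
    and eW: "\<And>K'. K' \<in> topspace (seq_space X \<rho>) \<Longrightarrow> (\<And>n. n < m0 \<Longrightarrow> near e (K n) (K' n)) \<Longrightarrow> K' \<in> W"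
    using openin_seq_space_imp_near[OF W(1) K] by metis
  define m where "m = max m0 (Suc (level s))"
  have "e / 3 > 0" using e by simp
  then have "\<exists>C. finite C \<and> C \<subseteq> K j \<and> near (e/3) (K j) C" for j
    using finite_near_subset[OF Kc] by simp
  then obtain C where C: "\<And>j. finite (C j)" "\<And>j. C j \<subseteq> K j" "\<And>j. near (e/3) (K j) (C j)"
    by metis
  have CX: "C j \<subseteq> X" for j using C(2) KX by blast
  obtain B0 where B0': "\<forall>j<m. finite (B0 j) \<and> B0 j \<subseteq> X \<and> near (e/3) (C j) (B0 j)"
    and dis0: "\<forall>i<m. \<forall>j<m. i \<noteq> j \<longrightarrow> B0 i \<inter> B0 j = {}"
    using disjoint_near[of C "e/3" m, OF C(1) CX \<open>e / 3 > 0\<close>] by (elim exE conjE)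
  note B0 = B0'[rule_format]
  define B where "B = (\<lambda>j. if j < m then B0 j else {})"
  have Bfin: "finite (B j)" and BX: "B j \<subseteq> X" for j using B0 by (auto simp: B_def)
  have dis: "i = j" if "y \<in> B i" "y \<in> B j" for i j y
    using dis0 that by (auto simp: B_def split: if_splits)
  \<comment> \<open>Two thirds of \<open>e\<close> are spent on passing from \<open>K j\<close> to
    \<open>C j\<close> and on to \<open>B j\<close>; the last third is left for the new radius
    \<open>d\<close>.\<close>
  have Bnear: "near (2*e/3) (K j) (B j)" if "j < m" for j
    using near_trans[OF C(3)[of j] _ KX CX BX[of j]] B0[OF that] that
    by (simp add: B_def) (metis (no_types, lifting) add_divide_distrib mult_2)
  define P where "P = (\<Union>j<m. B j)"
  have Pfin: "finite P" and PX: "P \<subseteq> X" using Bfin BX by (auto simp: P_def)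
  obtain d where d: "0 < d" "d \<le> e/3" "d \<le> radius s / 2"
    "\<And>x y. x \<in> pts s \<Longrightarrow> y \<in> P \<Longrightarrow> \<rho> x y < radius s \<Longrightarrow> \<rho> x y + d < radius s"
    "\<And>y z. y \<in> P \<Longrightarrow> z \<in> P \<Longrightarrow> y \<noteq> z \<Longrightarrow> 2 * d \<le> \<rho> y z"
    using fine_radius[OF s Pfin PX \<open>e / 3 > 0\<close>] by metis
  have "B \<in> W"
  proof (rule eW)
    show "B \<in> topspace (seq_space X \<rho>)" using Bfin BX finite_in_compact_subsets by simp
    show "near e (K n) (B n)" if "n < m0" for n
      using near_mono[OF Bnear[of n]] that e by (simp add: m_def)
  qed
  then have Bs: "B \<in> kset s" using W(3) by blast
  define k where "k = (\<lambda>y. THE j. y \<in> B j)"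
  have kB: "k y = j" if "y \<in> B j" for y j
    unfolding k_def using that dis by blast
  have Bm: "j < m" if "y \<in> B j" for y j using that by (auto simp: B_def split: if_splits)
  have PB: "y \<in> B (k y)" "k y < m" if "y \<in> P" for y
    using that kB by (auto simp: P_def)
  have Beq: "{y \<in> P. k y = j} = B j" for j
    using PB kB Bm by (auto simp: P_def)
  define pa where "pa = (\<lambda>y. SOME x. x \<in> pts s \<and> \<rho> x y < radius s)"
  have paI: "pa y = x" if "x \<in> pts s" "\<rho> x y < radius s" "y \<in> P" for x y
  proof -
    have "pa y \<in> pts s \<and> \<rho> (pa y) y < radius s"
      unfolding pa_def by (rule someI[of _ x]) (use that in blast)
    then show ?thesis using valid_center_unique[OF s _ that(1) _ _ that(2)] that(3) PX by blast
  qed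
  have pa: "pa y \<in> pts s \<and> \<rho> (pa y) y < radius s \<and> klab s (pa y) = k y" if y: "y \<in> P" "k y < level s" for y
  proof -
    obtain x where x: "x \<in> pts s" "klab s x = k y" "\<rho> x y < radius s"
      using Bs y(2) PB(1)[OF y(1)] unfolding kset_def near_def by blast
    then show ?thesis using paI[OF x(1,3) y(1)] by simp
  qed
  \<comment> \<open>Points of a \<open>B j\<close> with \<open>j\<close> below
    \<open>level s\<close> copy both labels of their center; all others are new for both sequences,
    with \<open>llab\<close> starting at \<open>level s\<close>.\<close>
  define l where "l = (\<lambda>y. if k y < level s then llab s (pa y) else level s)"
  define t where "t = State P k l m d"
  have t [simp]: "pts t = P" "klab t = k" "llab t = l" "level t = m" "radius t = d"
    by (simp_all add: t_def)
  have lm: "level s < m" by (simp add: m_def)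
  have "l y \<le> level s" if "y \<in> P" for y
    using pa[OF that] validD(6)[OF s] by (auto simp: l_def less_imp_le)
  then have lt: "l y < m" if "y \<in> P" for y using that lm by force
  have "valid t"
    unfolding valid_def using Pfin PX d lt PB(2) validD(4)[OF s] by auto
  moreover have "level s \<le> k y \<and> level s \<le> l y \<or>
        (\<exists>x\<in>pts s. encloses s t x y \<and> (same_labels s t x y \<or> level s \<le> k y \<and> llab s x < l y))"
    if y: "y \<in> P" for y
  proof (cases "k y < level s")
    case False
    then show ?thesis by (simp add: l_def)
  next
    case True
    note p = pa[OF y True]
    have "encloses s t (pa y) y" using d(4)[of "pa y" y] p y by (simp add: encloses_def)
    moreover have "same_labels s t (pa y) y"
      using p True by (simp add: same_labels_def l_def)
    ultimately show ?thesis using p by blast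
  qed
  moreover have "\<exists>y\<in>P. encloses s t x y \<and> same_labels s t x y" if x: "x \<in> pts s" for x
  proof -
    have kx: "klab s x < level s" using validD(5)[OF s x] .
    then obtain y where y: "y \<in> B (klab s x)" "\<rho> x y < radius s"
      using Bs x by (fastforce simp: kset_def near_def)
    have yP: "y \<in> P" using y(1) Bm by (auto simp: P_def)
    have "same_labels s t x y"
      using kB[OF y(1)] paI[OF x y(2) yP] kx by (simp add: same_labels_def l_def)
    moreover have "encloses s t x y" using d(4)[OF x yP y(2)] by (simp add: encloses_def)
    ultimately show ?thesis using yP by blast
  qed
  ultimately have "refines s t"
    unfolding refines_def using lm d(3) by simp
  moreover have "kset t \<subseteq> W"
  proof
    fix K' assume K': "K' \<in> kset t"
    then have K'top: "K' \<in> topspace (seq_space X \<rho>)" using kset_subset by blast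
    show "K' \<in> W"
    proof (rule eW[OF K'top])
      fix n assume "n < m0"
      then have n: "n < m" by (auto simp: m_def)
      have "near d {y \<in> P. k y = n} (K' n)" using K' n by (simp add: kset_def)
      then have "near d (B n) (K' n)" using Beq[of n] by simp
      moreover have "K' n \<subseteq> X" using K'top compact_subsets_subset by auto
      ultimately have "near (2*e/3 + d) (K n) (K' n)"
        using near_trans[OF Bnear[OF n] _ KX BX] by blast
      then show "near e (K n) (K' n)" using d(2) by (elim near_mono) simp
    qed
  qed
  ultimately show ?thesis by blast
qed

section \<open>The transfer in both directions\<close>

definition initial :: "'a state" where
  "initial = State {} (\<lambda>_. 0) (\<lambda>_. 0) 0 1"

lemma valid_initial: "valid initial"
  by (simp add: valid_def initial_def)

lemma kset_initial: "kset initial = topspace (seq_space X \<rho>)"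
  by (simp add: kset_def initial_def)

lemma lset_initial: "lset initial = topspace (increasing_seq_space X \<rho>)"
  by (simp add: lset_def initial_def)

lemma refinement_chainI:
  "(\<And>n. valid (s n)) \<Longrightarrow> (\<And>n. refines (s n) (s (Suc n))) \<Longrightarrow> refinement_chain X \<rho> s"
  by (simp add: refinement_chain_def refinement_chain_axioms_def bounded_compact_metric_axioms)

lemma union_in_transfer:
  assumes "refinement_chain X \<rho> s" and K: "\<And>n. K \<in> kset (s n)" and L: "\<And>n. L \<in> lset (s n)"
  shows "K \<in> seqs_with_union_in X \<rho> F \<longleftrightarrow> L \<in> seqs_with_union_in X \<rho> F \<inter> increasing_seqs X \<rho>"
proof -
  have "K \<in> topspace (seq_space X \<rho>)" "L \<in> increasing_seqs X \<rho>"
    using K[of 0] L[of 0] kset_subset lset_subset by blast+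
  moreover have "(\<Union>j. K j) = (\<Union>i. L i)"
    using refinement_chain.Union_eq[OF assms] .
  ultimately show ?thesis
    using increasing_seqs_subset by (auto simp: seqs_with_union_in_def)
qed

text \<open>States can be extended on either side and every chain has limits on both sides, so
  \<open>residual_in_transfer\<close> applies twice, with the roles of \<open>kset\<close> and
  \<open>lset\<close> exchanged.\<close>

lemma KN_residual_iff_increasing: "KN_residual X \<rho> F \<longleftrightarrow> KN_increasing_residual X \<rho> F"
proof
  let ?S = "seqs_with_union_in X \<rho> F"
  assume "KN_residual X \<rho> F"
  then have res: "residual_in (seq_space X \<rho>) ?S" by (simp add: KN_residual_def)
  show "KN_increasing_residual X \<rho> F"
    unfolding KN_increasing_residual_def
  proof (rule residual_in_transfer[OF res, where U = lset and V = kset and R = refines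
        and valid = valid and ?s0.0 = initial])
    show "?S \<inter> increasing_seqs X \<rho> \<subseteq> topspace (increasing_seq_space X \<rho>)" by simp
  next
    fix s L assume v: "\<And>n. valid (s n)" and r: "\<And>n. refines (s n) (s (Suc n))" and L: "\<And>n. L \<in> lset (s n)"
    note chain = refinement_chainI[of s, OF v r]
    obtain K where K: "\<And>n. K \<in> kset (s n)" using refinement_chain.kset_limit[OF chain] by blast
    then show "\<exists>K. (\<forall>n. K \<in> kset (s n)) \<and> (K \<in> ?S \<longrightarrow> L \<in> ?S \<inter> increasing_seqs X \<rho>)"
      using union_in_transfer[OF chain K L] by blast
  next
    show "valid t \<and> lset t \<subseteq> lset s" if "valid s" "refines s t" for s t
      using that lset_antimono refinesD(1) by blast
    show "refines s u" if "valid s" "refines s t" "refines t u" for s t u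
      using that by (rule refines_trans)
  qed (simp_all add: valid_initial lset_initial openin_kset openin_lset kset_nonempty lset_nonempty
      kset_extend lset_extend)
next
  let ?S = "seqs_with_union_in X \<rho> F"
  assume "KN_increasing_residual X \<rho> F"
  then have res: "residual_in (increasing_seq_space X \<rho>) (?S \<inter> increasing_seqs X \<rho>)"
    by (simp add: KN_increasing_residual_def)
  show "KN_residual X \<rho> F"
    unfolding KN_residual_def
  proof (rule residual_in_transfer[OF res, where U = kset and V = lset and R = refines
        and valid = valid and ?s0.0 = initial])
    show "?S \<subseteq> topspace (seq_space X \<rho>)" by (auto simp: seqs_with_union_in_def)
  next
    fix s K assume v: "\<And>n. valid (s n)" and r: "\<And>n. refines (s n) (s (Suc n))" and K: "\<And>n. K \<in> kset (s n)"
    note chain = refinement_chainI[of s, OF v r]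
    obtain L where L: "\<And>n. L \<in> lset (s n)" using refinement_chain.lset_limit[OF chain] by blast
    then show "\<exists>L. (\<forall>n. L \<in> lset (s n)) \<and> (L \<in> ?S \<inter> increasing_seqs X \<rho> \<longrightarrow> K \<in> ?S)"
      using union_in_transfer[OF chain K L] by blast
  next
    show "valid t \<and> kset t \<subseteq> kset s" if "valid s" "refines s t" for s t
      using that kset_antimono refinesD(1) by blast
    show "refines s u" if "valid s" "refines s t" "refines t u" for s t u
      using that by (rule refines_trans)
  qed (simp_all add: valid_initial kset_initial openin_kset openin_lset kset_nonempty lset_nonempty
      kset_extend lset_extend)
qed

end

theorem mainTheorem1:
  fixes X :: "'a set" and \<rho> :: "'a \<Rightarrow> 'a \<Rightarrow> real" and F :: "'a set set"
  assumes "Metric_space X \<rho>"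
    and "compact_space (Metric_space.mtopology X \<rho>)"
    and "dense_in_itself (Metric_space.mtopology X \<rho>)"
    and "\<And>x y. x \<in> X \<Longrightarrow> y \<in> X \<Longrightarrow> \<rho> x y \<le> 1"
    and "\<And>A. A \<in> F \<Longrightarrow> fsigma_in (Metric_space.mtopology X \<rho>) A"
  shows "KN_residual X \<rho> F \<longleftrightarrow> KN_increasing_residual X \<rho> F"
proof -
  interpret Metric_space X \<rho> by fact
  interpret perfect_compact_metric X \<rho>
    by unfold_locales (use assms in auto)
  show ?thesis by (rule KN_residual_iff_increasing)
qed

end
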